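(* The Miller forcing collapses the continuum onto $(\mathfrak{b}^{+\epsilon})^{V}$; that is, it forces that the continuum has the same cardinality as the ground-model cardinal $\mathfrak{b}^{+\epsilon}$.
   Context: The Miller forcing consists of trees $T$ of finite sequences of natural numbers such that for every $t\in T$ there is $s\in T$ with $t\subseteq s$ and $s$ having infinitely many immediate successors in $T$; conditions are ordered by reverse inclusion. For $X\in[\omega]^\omega$ (infinite subsets of $\omega$), $\mu_X$ is the increasing enumeration of $X$. A family $\mathcal{F}\subseteq[\omega]^\omega$ is weakly dominating if for every $Y\in[\omega]^\omega$ there is $X\in\mathcal{F}$ such that for infinitely many $i$, for all $j<2^i$, $|[\mu_X(2^i+j),\mu_X(2^i+j+1))\cap Y|\geq 2$; $\mathfrak{b}^{+\epsilon}$ is the minimal size of a weakly dominating family, and $(\mathfrak{b}^{+\epsilon})^V$ is its ground-model value. *)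

theory Defs
  imports Main "HOL-Library.Infinite_Set" "HOL-Library.Sublist"
begin

unbundle cardinal_syntax

section \<open>Forcing\<close>

text \<open>
  The ground model is the universe of HOL, and \<open>q \<le> p\<close> means that the condition \<open>q\<close> is stronger
  than \<open>p\<close>. A name is a set of pairs of a name and a condition. A datatype cannot recurse through
  unrestricted sets, so a set is given as the range of a partial function on an index type \<open>'i\<close>.
  If \<open>'i\<close> has cardinality \<open>\<lambda> \<ge> \<omega>\<close>, then \<open>('i, 'p) name\<close> consists, up to the enumeration of the
  pairs, of the names of hereditary cardinality at most \<open>\<lambda>\<close>. If moreover there are at most \<open>\<lambda>\<close>
  conditions, then these are names for exactly the sets of hereditary cardinality at most \<open>\<lambda>\<close>
  in the generic extension.
\<close>

datatype ('i, 'p) name = Name "'i \<rightharpoonup> ('i, 'p) name \<times> 'p"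

primrec elems :: "('i, 'p) name \<Rightarrow> (('i, 'p) name \<times> 'p) set" where
  "elems (Name f) = ran f"

definition name_of :: "(('i, 'p) name \<times> 'p) set \<Rightarrow> ('i, 'p) name" where
  "name_of S = (SOME x. elems x = S)"

lemma elems_name_of:
  fixes S :: "(('i, 'p) name \<times> 'p) set"
  assumes "|S| \<le>o |UNIV :: 'i set|"
  shows "elems (name_of S) = S"
proof -
  obtain g :: "('i, 'p) name \<times> 'p \<Rightarrow> 'i" where g: "inj_on g S"
    using assms by (auto simp: card_of_ordLeq[symmetric])
  define f where "f = (\<lambda>i. if i \<in> g ` S then Some (inv_into S g i) else None)"
  have "ran f = S"
  proof
    show "ran f \<subseteq> S"
      unfolding ran_def f_def using inv_into_into[of _ g S] by (force split: if_split_asm)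
    show "S \<subseteq> ran f"
    proof
      fix x
      assume "x \<in> S"
      then have "f (g x) = Some x"
        using g by (simp add: f_def)
      then show "x \<in> ran f"
        by (rule ranI)
    qed
  qed
  then have "elems (Name f) = S"
    by simp
  then show ?thesis
    unfolding name_of_def by (rule someI)
qed

definition name_elem_rel :: "(('i, 'p) name \<times> ('i, 'p) name) set" where
  "name_elem_rel = {(z, x). \<exists>r. (z, r) \<in> elems x}"

lemma wf_name_elem_rel: "wf name_elem_rel"
proof (rule wfUNIVI)
  fix P :: "('i, 'p) name \<Rightarrow> bool" and x
  assume step: "\<forall>x. (\<forall>z. (z, x) \<in> name_elem_rel \<longrightarrow> P z) \<longrightarrow> P x"
  show "P x"
  proof (induction x)
    case (Name f)
    show ?case
    proof (rule step[rule_format])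
      fix z
      assume "(z, Name f) \<in> name_elem_rel"
      then obtain r i where "f i = Some (z, r)"
        by (auto simp: name_elem_rel_def ran_def)
      then show "P z"
        using Name[of "f i" "(z, r)" z] by (metis fsts.intros option.set_intros rangeI fst_conv)
    qed
  qed
qed

definition dense_below :: "'p::order \<Rightarrow> ('p \<Rightarrow> bool) \<Rightarrow> bool" where
  "dense_below p D \<longleftrightarrow> (\<forall>q\<le>p. \<exists>s\<le>q. D s)"

text \<open>
  The usual simultaneous recursion for \<open>=\<close> and \<open>\<in>\<close>, with the clause for \<open>\<in>\<close> (see \<open>mem\<close> below)
  unfolded; \<open>x = y\<close> is forced by \<open>p\<close> iff \<open>p\<close> forces \<open>x \<subseteq> y\<close> and \<open>y \<subseteq> x\<close>.
\<close>

function eq :: "('i, 'p::order) name \<Rightarrow> ('i, 'p) name \<Rightarrow> 'p \<Rightarrow> bool" where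
  "eq x y p \<longleftrightarrow>
     (\<forall>(z, r)\<in>elems x. \<forall>q\<le>p. q \<le> r \<longrightarrow> dense_below q (\<lambda>s. \<exists>(w, t)\<in>elems y. s \<le> t \<and> eq z w s)) \<and>
     (\<forall>(w, t)\<in>elems y. \<forall>q\<le>p. q \<le> t \<longrightarrow> dense_below q (\<lambda>s. \<exists>(z, r)\<in>elems x. s \<le> r \<and> eq z w s))"
  by pat_completeness auto
termination
proof (relation "inv_image name_elem_rel fst")
  show "wf (inv_image name_elem_rel fst)"
    by (rule wf_inv_image[OF wf_name_elem_rel])
qed (auto simp: name_elem_rel_def)

declare eq.simps [simp del]

definition mem :: "('i, 'p::order) name \<Rightarrow> ('i, 'p) name \<Rightarrow> 'p \<Rightarrow> bool" where
  "mem z y p \<longleftrightarrow> dense_below p (\<lambda>s. \<exists>(w, t)\<in>elems y. s \<le> t \<and> eq z w s)"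

text \<open>
  A sentence of the forcing language is represented by the predicate that holds of the conditions
  forcing it. Negation, conjunction and universal quantification have the usual forcing clauses;
  the other connectives are their classical abbreviations.
\<close>

type_synonym 'p sentence = "'p \<Rightarrow> bool"

definition Neg :: "'p::order sentence \<Rightarrow> 'p sentence" where
  "Neg \<phi> p \<longleftrightarrow> (\<forall>q\<le>p. \<not> \<phi> q)"

definition Conj :: "'p::order sentence \<Rightarrow> 'p sentence \<Rightarrow> 'p sentence" where
  "Conj \<phi> \<psi> p \<longleftrightarrow> \<phi> p \<and> \<psi> p"

definition All_name :: "(('i, 'p::order) name \<Rightarrow> 'p sentence) \<Rightarrow> 'p sentence" where
  "All_name \<phi> p \<longleftrightarrow> (\<forall>x. \<phi> x p)"

definition Disj :: "'p::order sentence \<Rightarrow> 'p sentence \<Rightarrow> 'p sentence" where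
  "Disj \<phi> \<psi> = Neg (Conj (Neg \<phi>) (Neg \<psi>))"

definition Imp :: "'p::order sentence \<Rightarrow> 'p sentence \<Rightarrow> 'p sentence" where
  "Imp \<phi> \<psi> = Neg (Conj \<phi> (Neg \<psi>))"

definition Iff :: "'p::order sentence \<Rightarrow> 'p sentence \<Rightarrow> 'p sentence" where
  "Iff \<phi> \<psi> = Conj (Imp \<phi> \<psi>) (Imp \<psi> \<phi>)"

definition Ex_name :: "(('i, 'p::order) name \<Rightarrow> 'p sentence) \<Rightarrow> 'p sentence" where
  "Ex_name \<phi> = Neg (All_name (\<lambda>x. Neg (\<phi> x)))"

notation eq (infix "\<^bold>=" 50)
notation mem (infix "\<^bold>\<in>" 50)
notation Neg ("\<^bold>\<not> _" [40] 40)
notation Conj (infixr "\<^bold>\<and>" 35)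
notation Disj (infixr "\<^bold>\<or>" 30)
notation Imp (infixr "\<^bold>\<longrightarrow>" 25)
notation Iff (infixr "\<^bold>\<longleftrightarrow>" 25)
notation All_name (binder "\<^bold>\<forall>" 10)
notation Ex_name (binder "\<^bold>\<exists>" 10)

definition forced :: "'p::order sentence \<Rightarrow> bool" ("\<tturnstile> _" [5] 5) where
  "(\<tturnstile> \<phi>) \<longleftrightarrow> (\<forall>p. \<phi> p)"


section \<open>Set theory in the forcing language\<close>

definition is_power_set :: "('i, 'p::order) name \<Rightarrow> ('i, 'p) name \<Rightarrow> 'p sentence" where
  "is_power_set c a = (\<^bold>\<forall>x. x \<^bold>\<in> c \<^bold>\<longleftrightarrow> (\<^bold>\<forall>z. z \<^bold>\<in> x \<^bold>\<longrightarrow> z \<^bold>\<in> a))"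

definition is_upair :: "('i, 'p::order) name \<Rightarrow> ('i, 'p) name \<Rightarrow> ('i, 'p) name \<Rightarrow> 'p sentence" where
  "is_upair u x y = (\<^bold>\<forall>z. z \<^bold>\<in> u \<^bold>\<longleftrightarrow> z \<^bold>= x \<^bold>\<or> z \<^bold>= y)"

definition is_opair :: "('i, 'p::order) name \<Rightarrow> ('i, 'p) name \<Rightarrow> ('i, 'p) name \<Rightarrow> 'p sentence" where
  "is_opair u x y = (\<^bold>\<exists>a b. is_upair a x x \<^bold>\<and> is_upair b x y \<^bold>\<and> is_upair u a b)"

definition is_bijection :: "('i, 'p::order) name \<Rightarrow> ('i, 'p) name \<Rightarrow> ('i, 'p) name \<Rightarrow> 'p sentence" where
  "is_bijection f a b =
     ((\<^bold>\<forall>u. u \<^bold>\<in> f \<^bold>\<longrightarrow> (\<^bold>\<exists>x y. x \<^bold>\<in> a \<^bold>\<and> y \<^bold>\<in> b \<^bold>\<and> is_opair u x y)) \<^bold>\<and>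
      (\<^bold>\<forall>x. x \<^bold>\<in> a \<^bold>\<longrightarrow> (\<^bold>\<exists>y u. u \<^bold>\<in> f \<^bold>\<and> is_opair u x y)) \<^bold>\<and>
      (\<^bold>\<forall>y. y \<^bold>\<in> b \<^bold>\<longrightarrow> (\<^bold>\<exists>x u. u \<^bold>\<in> f \<^bold>\<and> is_opair u x y)) \<^bold>\<and>
      (\<^bold>\<forall>u u' x x' y y'.
         u \<^bold>\<in> f \<^bold>\<and> u' \<^bold>\<in> f \<^bold>\<and> is_opair u x y \<^bold>\<and> is_opair u' x' y' \<^bold>\<longrightarrow> (x \<^bold>= x' \<^bold>\<longleftrightarrow> y \<^bold>= y')))"

definition same_cardinality :: "('i, 'p::order) name \<Rightarrow> ('i, 'p) name \<Rightarrow> 'p sentence" where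
  "same_cardinality a b = (\<^bold>\<exists>f. is_bijection f a b)"

text \<open>
  For a well-order \<open>r\<close>, \<open>check_below r x\<close> is the canonical name of the von Neumann ordinal of the
  initial segment strictly below \<open>x\<close>, and \<open>check_ordinal r\<close> that of the order type of \<open>r\<close>.
  This requires that the field of \<open>r\<close> is not larger than \<open>'i\<close>.
\<close>

definition check_below :: "'a rel \<Rightarrow> 'a \<Rightarrow> ('i, 'p::order_top) name" where
  "check_below r = wfrec (r - Id) (\<lambda>f x. name_of {(f y, top) | y. (y, x) \<in> r - Id})"

definition check_ordinal :: "'a rel \<Rightarrow> ('i, 'p::order_top) name" where
  "check_ordinal r = name_of {(check_below r y, top) | y. y \<in> Field r}"

lemma elems_check_ordinal:
  assumes "|Field r| \<le>o |UNIV :: 'i set|"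
  shows "elems (check_ordinal r :: ('i, 'p::order_top) name) =
    {(check_below r y, top) | y. y \<in> Field r}"
  unfolding check_ordinal_def
  unfolding Setcompr_eq_image
  by (rule elems_name_of) (rule ordLeq_transitive[OF card_of_image assms])

lemma elems_check_below:
  assumes "Well_order r" and "|Field r| \<le>o |UNIV :: 'i set|"
  shows "elems (check_below r x :: ('i, 'p::order_top) name) =
    {(check_below r y, top) | y. (y, x) \<in> r - Id}" (is "_ = ?S")
proof -
  have wf: "wf (r - Id)"
    using assms(1) by (simp add: well_order_on_def)
  have "check_below r x = name_of {(cut (check_below r) (r - Id) x y, top) | y. (y, x) \<in> r - Id}"
    unfolding check_below_def by (subst wfrec[OF wf]) (rule refl)
  also have "\<dots> = name_of ?S"
    by (rule arg_cong[where f = name_of]) (force simp: cut_apply)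
  finally have "check_below r x = (name_of ?S :: ('i, 'p) name)" .
  moreover have "?S \<subseteq> (\<lambda>y. (check_below r y, top)) ` Field r"
    by (auto simp: Field_def)
  then have "|?S| \<le>o |UNIV :: 'i set|"
    by (meson assms(2) card_of_image card_of_mono1 ordLeq_transitive)
  ultimately show ?thesis
    by (simp only: elems_name_of)
qed

abbreviation omega_name :: "('i, 'p::order_top) name" ("\<omega>\<^sup>\<or>") where
  "omega_name \<equiv> check_ordinal natLeq"


section \<open>Miller forcing\<close>

definition miller_tree :: "nat list set \<Rightarrow> bool" where
  "miller_tree T \<longleftrightarrow> T \<noteq> {} \<and> (\<forall>t\<in>T. \<forall>s. prefix s t \<longrightarrow> s \<in> T) \<and>
     (\<forall>t\<in>T. \<exists>s\<in>T. prefix t s \<and> infinite {n. s @ [n] \<in> T})"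

typedef miller = "{T. miller_tree T}"
  morphisms tree Miller
proof
  show "UNIV \<in> {T. miller_tree T}"
    by (auto simp: miller_tree_def)
qed

text \<open>The paper's reverse inclusion makes smaller trees stronger; here stronger is smaller.\<close>

instantiation miller :: order_top
begin

definition less_eq_miller :: "miller \<Rightarrow> miller \<Rightarrow> bool" where
  "less_eq_miller S T \<longleftrightarrow> tree S \<subseteq> tree T"

definition less_miller :: "miller \<Rightarrow> miller \<Rightarrow> bool" where
  "less_miller S T \<longleftrightarrow> tree S \<subset> tree T"

definition top_miller :: miller where
  "top_miller = Miller UNIV"

instance
proof
  have "tree top = UNIV"
    unfolding top_miller_def by (rule Miller_inverse) (auto simp: miller_tree_def)
  then show "T \<le> top" for T :: miller
    by (simp add: less_eq_miller_def)
qed (auto simp: less_eq_miller_def less_miller_def tree_inject)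

end


section \<open>The cardinal characteristic\<close>

definition weakly_dominating :: "nat set set \<Rightarrow> bool" where
  "weakly_dominating F \<longleftrightarrow> (\<forall>X\<in>F. infinite X) \<and>
     (\<forall>Y. infinite Y \<longrightarrow> (\<exists>X\<in>F. INFM i. \<forall>j<2 ^ i.
        card ({enumerate X (2 ^ i + j)..<enumerate X (2 ^ i + j + 1)} \<inter> Y) \<ge> 2))"

text \<open>As a cardinal in the sense of \<open>Card_order\<close>, unique up to order isomorphism.\<close>

definition b_plus_eps :: "nat set rel" ("\<bb>\<^sup>+\<^sup>\<epsilon>") where
  "b_plus_eps = |SOME F. weakly_dominating F \<and> (\<forall>G. weakly_dominating G \<longrightarrow> |F| \<le>o |G| )|"

lemma weakly_dominating_infinite_sets: "weakly_dominating {X. infinite X}"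
  unfolding weakly_dominating_def
proof (intro conjI allI impI)
  fix Y :: "nat set"
  assume Y: "infinite Y"
  define g where "g n = enumerate Y (2 * n)" for n
  have mono: "strict_mono g"
    unfolding g_def by (intro strict_monoI) (simp add: Y enumerate_mono)
  then have X: "infinite (range g)"
    by (simp add: range_inj_infinite strict_mono_imp_inj_on)
  have "enumerate (range g) n = g n" for n
  proof (induction n)
    case 0
    show ?case
      unfolding enumerate_0
      by (rule Least_equality) (use mono in \<open>auto simp: strict_mono_less_eq\<close>)
  next
    case (Suc n)
    show ?case
      unfolding enumerate_Suc''[OF X] Suc
      by (rule Least_equality) (use mono in \<open>auto simp: strict_mono_less_eq strict_mono_less\<close>)
  qed
  then have "enumerate (range g) = g" ..
  have "2 \<le> card ({g n..<g (n + 1)} \<inter> Y)" for n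
  proof -
    have "{enumerate Y (2 * n), enumerate Y (2 * n + 1)} \<subseteq> {g n..<g (n + 1)} \<inter> Y"
      using Y by (auto simp: g_def enumerate_in_set enumerate_mono less_imp_le)
    then have "card {enumerate Y (2 * n), enumerate Y (2 * n + 1)} \<le> card ({g n..<g (n + 1)} \<inter> Y)"
      by (intro card_mono) auto
    moreover have "enumerate Y (2 * n) < enumerate Y (2 * n + 1)"
      using Y by (simp add: enumerate_mono)
    ultimately show ?thesis by simp
  qed
  with \<open>enumerate (range g) = g\<close> X
  show "\<exists>X\<in>{X. infinite X}. INFM i. \<forall>j<2 ^ i.
      2 \<le> card ({enumerate X (2 ^ i + j)..<enumerate X (2 ^ i + j + 1)} \<inter> Y)"
    by (intro bexI[of _ "range g"]) auto
qed auto

lemma b_plus_eps_minimal: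
  obtains F where "weakly_dominating F" and "\<bb>\<^sup>+\<^sup>\<epsilon> = |F|"
    and "\<And>G. weakly_dominating G \<Longrightarrow> \<bb>\<^sup>+\<^sup>\<epsilon> \<le>o |G|"
proof -
  let ?P = "\<lambda>F. weakly_dominating F \<and> (\<forall>G. weakly_dominating G \<longrightarrow> |F| \<le>o |G| )"
  have "\<exists>r\<in>card_of ` {F. weakly_dominating F}. \<forall>r'\<in>card_of ` {F. weakly_dominating F}. r \<le>o r'"
    using weakly_dominating_infinite_sets
    by (intro exists_minim_Well_order) (auto simp: card_of_Well_order)
  then have "\<exists>F. ?P F"
    by auto
  then have "?P (SOME F. ?P F)"
    by (rule someI_ex[of ?P])
  then show ?thesis
    using that unfolding b_plus_eps_def by blast
qed

end

(*
  Fix a weakly dominating family F of minimal size. To X in F, a node s and g <= omega belongs the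
  Miller tree of all nodes that, beyond s, have their weights in the union over i of the blocks
  [mu_X(2^i + j), mu_X(2^i + j + 1)) where j < 2^i is the number with binary digits g restricted to i.
  Two such unions are almost disjoint for different g, so the trees are pairwise incompatible.
  Given a Miller tree p, let Y be so sparse that between two of its elements every lighter splitting
  node of p can be extended to another splitting node. If X weakly dominates Y, then each
  of the 2^i blocks of level i, for infinitely many i, leaves room for such a step, whatever g is;
  so p is compatible with the trees of all g, for s a splitting node of p. Hence the generic filter
  maps (X, s) to the g whose tree it contains, and by genericity this is onto the reals of the
  ground model. By fusion, every real of the extension has a name coded by a real of the ground
  model, which gives a surjection from F x omega^(<omega) onto the continuum of the extension. It is
  turned into a bijection by hand, so that no Schroeder-Bernstein theorem is needed
  in the forcing language.
*)
theory Submission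
  imports Defs "HOL-Library.Nat_Bijection" "HOL-Library.Countable"
begin

section \<open>The forcing relation\<close>

text \<open>The regular open sets of conditions, that is, the truth values in the Boolean
  completion. Every sentence built from \<open>eq\<close> and \<open>mem\<close> is one, so it may
  be proved at \<open>p\<close> by finding, below each \<open>q \<le> p\<close>, some condition that
  forces it.\<close>

definition regular :: "'p::order sentence \<Rightarrow> bool" where
  "regular \<phi> \<longleftrightarrow> (\<forall>p. \<phi> p \<longleftrightarrow> dense_below p \<phi>)"

lemma regular_mono: "regular \<phi> \<Longrightarrow> \<phi> p \<Longrightarrow> q \<le> p \<Longrightarrow> \<phi> q"
  unfolding regular_def dense_below_def by (meson order_trans)

lemma regular_dense: "regular \<phi> \<Longrightarrow> (\<And>q. q \<le> p \<Longrightarrow> \<exists>s\<le>q. \<phi> s) \<Longrightarrow> \<phi> p"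
  unfolding regular_def dense_below_def by blast

lemma regularI:
  assumes "\<And>p q. \<phi> p \<Longrightarrow> q \<le> p \<Longrightarrow> \<phi> q"
    and "\<And>p. (\<And>q. q \<le> p \<Longrightarrow> \<exists>s\<le>q. \<phi> s) \<Longrightarrow> \<phi> p"
  shows "regular \<phi>"
  unfolding regular_def dense_below_def using assms by blast

lemma regular_dense_below: "regular (\<lambda>p. dense_below p D)"
proof (rule regularI)
  show "dense_below q D" if "dense_below p D" "q \<le> p" for p q
    using that unfolding dense_below_def by (blast intro: order_trans)
  show "dense_below p D" if *: "\<And>q. q \<le> p \<Longrightarrow> \<exists>s\<le>q. dense_below s D" for p
    unfolding dense_below_def
  proof (intro allI impI)
    fix q
    assume "q \<le> p"
    then obtain s where "s \<le> q" "dense_below s D"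
      using * by blast
    then show "\<exists>s\<le>q. D s"
      unfolding dense_below_def by (blast intro: order_trans)
  qed
qed

text \<open>Covers \<open>Disj\<close>, \<open>Imp\<close> and \<open>Ex_name\<close>, whose
  abbreviations begin with a negation.\<close>

lemma regular_Neg:
  assumes "\<And>p q. \<phi> p \<Longrightarrow> q \<le> p \<Longrightarrow> \<phi> q"
  shows "regular (\<^bold>\<not> \<phi>)"
proof (rule regularI)
  show "(\<^bold>\<not> \<phi>) q" if "(\<^bold>\<not> \<phi>) p" "q \<le> p" for p q
    using that unfolding Neg_def by (blast intro: order_trans)
  show "(\<^bold>\<not> \<phi>) p" if *: "\<And>q. q \<le> p \<Longrightarrow> \<exists>s\<le>q. (\<^bold>\<not> \<phi>) s" for p
    unfolding Neg_def
  proof (intro allI impI notI)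
    fix q
    assume "q \<le> p" "\<phi> q"
    then obtain s where "s \<le> q" "(\<^bold>\<not> \<phi>) s"
      using * by blast
    then show False
      using assms[OF \<open>\<phi> q\<close>] unfolding Neg_def by blast
  qed
qed

lemma regular_Conj: "regular \<phi> \<Longrightarrow> regular \<psi> \<Longrightarrow> regular (\<phi> \<^bold>\<and> \<psi>)"
  unfolding regular_def Conj_def dense_below_def by (meson order_trans order.refl)

lemma regular_All: "(\<And>x. regular (\<phi> x)) \<Longrightarrow> regular (All_name \<phi>)"
  unfolding regular_def All_name_def dense_below_def by (meson order_trans order.refl)

lemma Neg_mono: "(\<^bold>\<not> \<phi>) p \<Longrightarrow> q \<le> p \<Longrightarrow> (\<^bold>\<not> \<phi>) q"
  unfolding Neg_def by (blast intro: order_trans)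

lemma regular_Disj: "regular (\<phi> \<^bold>\<or> \<psi>)"
  unfolding Disj_def by (rule regular_Neg) (auto simp: Conj_def dest: Neg_mono)

lemma regular_Imp: "regular \<phi> \<Longrightarrow> regular (\<phi> \<^bold>\<longrightarrow> \<psi>)"
  unfolding Imp_def by (rule regular_Neg) (auto simp: Conj_def dest: Neg_mono regular_mono)

lemma regular_Ex: "regular (Ex_name \<phi>)"
  unfolding Ex_name_def by (rule regular_Neg) (auto simp: All_name_def dest: Neg_mono)

lemma regular_Iff: "regular \<phi> \<Longrightarrow> regular \<psi> \<Longrightarrow> regular (\<phi> \<^bold>\<longleftrightarrow> \<psi>)"
  by (simp add: Iff_def regular_Imp regular_Conj)

lemma Ex_name_iff: "(Ex_name \<phi>) p \<longleftrightarrow> (\<forall>q\<le>p. \<exists>s\<le>q. \<exists>x. \<phi> x s)"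
  unfolding Ex_name_def Neg_def All_name_def by blast

lemma Disj_iff: "(\<phi> \<^bold>\<or> \<psi>) p \<longleftrightarrow> (\<forall>q\<le>p. \<exists>s\<le>q. \<phi> s \<or> \<psi> s)"
  unfolding Disj_def Neg_def Conj_def by blast

text \<open>The abbreviation by itself says that each condition forcing \<open>\<phi>\<close> has a
  stronger one forcing \<open>\<psi>\<close>; regularity of \<open>\<psi>\<close> removes the
  density.\<close>

lemma Imp_iff:
  assumes "regular \<phi>" "regular \<psi>"
  shows "(\<phi> \<^bold>\<longrightarrow> \<psi>) p \<longleftrightarrow> (\<forall>q\<le>p. \<phi> q \<longrightarrow> \<psi> q)"
proof -
  have "(\<phi> \<^bold>\<longrightarrow> \<psi>) p \<longleftrightarrow> (\<forall>q\<le>p. \<phi> q \<longrightarrow> (\<exists>s\<le>q. \<psi> s))"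
    unfolding Imp_def Neg_def Conj_def by blast
  also have "\<dots> \<longleftrightarrow> (\<forall>q\<le>p. \<phi> q \<longrightarrow> \<psi> q)"
    using regular_mono[OF assms(1)] regular_dense[OF assms(2)] by (metis order_trans order.refl)
  finally show ?thesis .
qed

lemma Iff_iff:
  assumes "regular \<phi>" "regular \<psi>"
  shows "(\<phi> \<^bold>\<longleftrightarrow> \<psi>) p \<longleftrightarrow> (\<forall>q\<le>p. \<phi> q \<longleftrightarrow> \<psi> q)"
  unfolding Iff_def Conj_def Imp_iff[OF assms] Imp_iff[OF assms(2,1)] by blast

section \<open>Equality and membership of names\<close>

lemma eq_iff:
  "eq x y p \<longleftrightarrow>
    (\<forall>z r q. (z, r) \<in> elems x \<longrightarrow> q \<le> p \<longrightarrow> q \<le> r \<longrightarrow>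
      dense_below q (\<lambda>s. \<exists>(w, t)\<in>elems y. s \<le> t \<and> eq z w s)) \<and>
    (\<forall>w t q. (w, t) \<in> elems y \<longrightarrow> q \<le> p \<longrightarrow> q \<le> t \<longrightarrow>
      dense_below q (\<lambda>s. \<exists>(z, r)\<in>elems x. s \<le> r \<and> eq z w s))"
  by (subst eq.simps) auto

lemma regular_eq: "regular (eq x y)"
proof (rule regularI)
  show "eq x y q" if "eq x y p" "q \<le> p" for p q
    using that unfolding eq_iff[of x y] by (meson order_trans)
  show "eq x y p" if *: "\<And>q. q \<le> p \<Longrightarrow> \<exists>s\<le>q. eq x y s" for p
    unfolding eq_iff[of x y]
  proof (intro conjI allI impI; rule regular_dense[OF regular_dense_below])
    fix z r q q'
    assume "(z, r) \<in> elems x" "q \<le> p" "q \<le> r" "q' \<le> q"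
    moreover obtain s where "s \<le> q'" "eq x y s"
      using * \<open>q \<le> p\<close> \<open>q' \<le> q\<close> by (meson order_trans)
    ultimately show "\<exists>s\<le>q'. dense_below s (\<lambda>s. \<exists>(w, t)\<in>elems y. s \<le> t \<and> eq z w s)"
      unfolding eq_iff[of x y] by (meson order_trans order.refl)
  next
    fix w t q q'
    assume "(w, t) \<in> elems y" "q \<le> p" "q \<le> t" "q' \<le> q"
    moreover obtain s where "s \<le> q'" "eq x y s"
      using * \<open>q \<le> p\<close> \<open>q' \<le> q\<close> by (meson order_trans)
    ultimately show "\<exists>s\<le>q'. dense_below s (\<lambda>s. \<exists>(z, r)\<in>elems x. s \<le> r \<and> eq z w s)"
      unfolding eq_iff[of x y] by (meson order_trans order.refl)
  qed
qed

lemma regular_mem: "regular (mem x y)"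
  unfolding mem_def[abs_def] by (rule regular_dense_below)

lemmas eq_mono = regular_mono[OF regular_eq]
lemmas mem_mono = regular_mono[OF regular_mem]

lemma name_induct [case_names step]:
  assumes "\<And>x. (\<And>z r. (z, r) \<in> elems x \<Longrightarrow> P z) \<Longrightarrow> P x"
  shows "P (x :: ('i, 'p) name)"
  using wf_name_elem_rel
proof (induction x rule: wf_induct_rule)
  case (less x)
  then show ?case
    by (metis (mono_tags, lifting) assms case_prodI mem_Collect_eq name_elem_rel_def)
qed

text \<open>Both clauses of \<open>eq\<close> compare an element of the left name with one of the
  right, in this order, so the symmetry is not syntactic; the induction hypothesis turns the inner
  comparisons round.\<close>

lemma eq_sym: "eq x y p \<Longrightarrow> eq y x p"
proof -
  have "\<forall>y p. eq x y p \<longleftrightarrow> eq y x p"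
  proof (induction x rule: name_induct)
    case (step x)
    then have 1: "(\<lambda>s. \<exists>(w, t)\<in>elems y. s \<le> t \<and> eq z w s) = (\<lambda>s. \<exists>(w, t)\<in>elems y. s \<le> t \<and> eq w z s)"
      if "(z, r) \<in> elems x" for y z r
      using that by fastforce
    have 2: "(\<lambda>s. \<exists>(z, r)\<in>elems x. s \<le> r \<and> eq z w s) = (\<lambda>s. \<exists>(z, r)\<in>elems x. s \<le> r \<and> eq w z s)" for w
      using step by fastforce
    show ?case
      unfolding eq.simps[of x] eq.simps[of _ x] using 1 2 by auto
  qed
  then show "eq x y p \<Longrightarrow> eq y x p" by blast
qed

text \<open>Symmetry turns the inner clauses of \<open>eq\<close> into \<open>mem\<close>, so
  equality becomes mutual inclusion; the later proofs use this form in place of the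
  recursion.\<close>

lemma eq_iff_mem:
  "eq x y p \<longleftrightarrow>
    (\<forall>z r q. (z, r) \<in> elems x \<longrightarrow> q \<le> p \<longrightarrow> q \<le> r \<longrightarrow> mem z y q) \<and>
    (\<forall>z r q. (z, r) \<in> elems y \<longrightarrow> q \<le> p \<longrightarrow> q \<le> r \<longrightarrow> mem z x q)"
proof -
  have "(\<lambda>s. \<exists>(z, r)\<in>elems x. s \<le> r \<and> eq z w s) = (\<lambda>s. \<exists>(z, r)\<in>elems x. s \<le> r \<and> eq w z s)" for w
    using eq_sym by fastforce
  then show ?thesis
    unfolding eq.simps[of x y] mem_def by auto
qed

lemma memI:
  assumes "(w, t) \<in> elems y" "eq z w p" "p \<le> t"
  shows "mem z y p"
  unfolding mem_def dense_below_def
proof (intro allI impI exI conjI bexI, rule order.refl)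
  fix q
  assume "q \<le> p"
  then show "case (w, t) of (w, t) \<Rightarrow> q \<le> t \<and> eq z w q"
    using assms eq_mono order_trans by (metis case_prodI)
qed (rule assms)

lemma memE:
  assumes "mem z y p"
  obtains w t s where "(w, t) \<in> elems y" "s \<le> p" "s \<le> t" "eq z w s"
  using assms unfolding mem_def dense_below_def by blast

lemma name_eq_refl: "eq x x p"
proof (induction x arbitrary: p rule: name_induct)
  case (step x)
  then have "mem z x q" if "(z, r) \<in> elems x" "q \<le> r" for z r q
    using that memI by blast
  then show ?case
    unfolding eq_iff_mem[of x x] by blast
qed

text \<open>Induction on \<open>x\<close>: an element \<open>u\<close> of \<open>x\<close> is
  matched with some \<open>v\<close> of \<open>y\<close>, and \<open>v\<close> with some
  \<open>w\<close> of \<open>z\<close>. The opposite direction ends with the same kind of triple, so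
  the hypothesis for the element of \<open>x\<close> serves both times.\<close>

lemma eq_trans: "eq x y p \<Longrightarrow> eq y z p \<Longrightarrow> eq x z p"
proof (induction x arbitrary: y z p rule: name_induct)
  case (step x)
  have "mem u z q" if u: "(u, r) \<in> elems x" "q \<le> p" "q \<le> r" for u r q
  proof (rule regular_dense[OF regular_mem])
    fix q' assume q': "q' \<le> q"
    have "mem u y q'"
      using step.prems(1) u q' unfolding eq_iff_mem by (meson order_trans)
    then obtain v t s where s: "(v, t) \<in> elems y" "s \<le> q'" "s \<le> t" "eq u v s"
      by (rule memE)
    have "mem v z s"
      using step.prems(2) s u q' unfolding eq_iff_mem by (meson order_trans)
    then obtain w t' s' where s': "(w, t') \<in> elems z" "s' \<le> s" "s' \<le> t'" "eq v w s'"
      by (rule memE)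
    have "eq u w s'"
      using step.IH[OF u(1) eq_mono[OF s(4) s'(2)] s'(4)] .
    then show "\<exists>s\<le>q'. mem u z s"
      using memI s s' by (meson order_trans)
  qed
  moreover have "mem w x q" if w: "(w, r) \<in> elems z" "q \<le> p" "q \<le> r" for w r q
  proof (rule regular_dense[OF regular_mem])
    fix q' assume q': "q' \<le> q"
    have "mem w y q'"
      using step.prems(2) w q' unfolding eq_iff_mem by (meson order_trans)
    then obtain v t s where s: "(v, t) \<in> elems y" "s \<le> q'" "s \<le> t" "eq w v s"
      by (rule memE)
    have "mem v x s"
      using step.prems(1) s w q' unfolding eq_iff_mem by (meson order_trans)
    then obtain u t' s' where s': "(u, t') \<in> elems x" "s' \<le> s" "s' \<le> t'" "eq v u s'"
      by (rule memE)
    have "eq u w s'"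
      using step.IH[OF s'(1) eq_sym[OF s'(4)] eq_mono[OF eq_sym[OF s(4)] s'(2)]] .
    then show "\<exists>s\<le>q'. mem w x s"
      using memI s s' eq_sym by (meson order_trans)
  qed
  ultimately show ?case
    unfolding eq_iff_mem by blast
qed

lemma mem_cong_left: "mem z y p \<Longrightarrow> eq z z' p \<Longrightarrow> mem z' y p"
  unfolding mem_def dense_below_def
  by (smt (verit, ccfv_threshold) eq_mono eq_sym eq_trans order_trans case_prodE case_prodI2 prod.inject)

lemma mem_cong_right:
  assumes "mem z y p" "eq y y' p"
  shows "mem z y' p"
proof (rule regular_dense[OF regular_mem])
  fix q assume "q \<le> p"
  with assms(1) obtain w t s where s: "(w, t) \<in> elems y" "s \<le> q" "s \<le> t" "eq z w s"
    using mem_mono memE by meson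
  then have "mem w y' s"
    using assms(2) \<open>q \<le> p\<close> unfolding eq_iff_mem by (meson order_trans)
  then show "\<exists>s\<le>q. mem z y' s"
    using mem_cong_left[OF _ eq_sym] s by blast
qed

lemma eqI:
  assumes "\<And>z q. q \<le> p \<Longrightarrow> mem z x q \<Longrightarrow> mem z y q"
    and "\<And>z q. q \<le> p \<Longrightarrow> mem z y q \<Longrightarrow> mem z x q"
  shows "eq x y p"
  unfolding eq_iff_mem using assms memI[OF _ name_eq_refl] by blast

text \<open>Foundation: if \<open>x \<in> x\<close> were forced, \<open>x\<close> would be equal at
  a stronger condition to one of its elements \<open>w\<close>, and then \<open>w \<in> w\<close>,
  against the induction hypothesis.\<close>

lemma mem_irrefl: "\<not> mem x x p"
proof (induction x arbitrary: p rule: name_induct)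
  case (step x)
  show ?case
  proof
    assume "mem x x p"
    then obtain w t s where s: "(w, t) \<in> elems x" "s \<le> p" "s \<le> t" "eq x w s"
      by (rule memE)
    then have "mem w w s"
      using memI[OF _ name_eq_refl] mem_cong_right by blast
    with step s(1) show False by blast
  qed
qed

lemma Ex_nameI: "regular (\<phi> x) \<Longrightarrow> \<phi> x p \<Longrightarrow> (Ex_name \<phi>) p"
  unfolding Ex_name_iff using regular_mono by blast

section \<open>Pairs, canonical ordinals and forced bijections\<close>

lemma elems_name_of_finite:
  fixes S :: "(('i, 'p) name \<times> 'p) set"
  assumes "infinite (UNIV :: 'i set)" "finite S"
  shows "elems (name_of S) = S"
proof (rule elems_name_of)
  have "|S| <o |UNIV :: 'i set|"
    using assms by (intro finite_ordLess_infinite card_of_Well_order) (simp_all add: Field_card_of)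
  then show "|S| \<le>o |UNIV :: 'i set|"
    by (rule ordLess_imp_ordLeq)
qed

lemma is_upair_iff:
  "is_upair u x y p \<longleftrightarrow>
    (\<forall>z. \<forall>q\<le>p. mem z u q \<longleftrightarrow> (\<forall>r\<le>q. \<exists>s\<le>r. eq z x s \<or> eq z y s))"
  unfolding is_upair_def All_name_def by (simp add: Iff_iff regular_mem regular_Disj Disj_iff)

lemma regular_is_upair: "regular (is_upair u x y)"
  unfolding is_upair_def by (intro regular_All regular_Iff regular_mem regular_Disj)

lemma regular_is_opair: "regular (is_opair u x y)"
  unfolding is_opair_def by (rule regular_Ex)

lemmas is_upair_mono = regular_mono[OF regular_is_upair]
lemmas is_opair_mono = regular_mono[OF regular_is_opair]

lemma is_upair_mem:
  assumes "is_upair u x y p"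
  shows "mem x u p" "mem y u p"
  using assms unfolding is_upair_iff by (metis name_eq_refl order.refl)+

lemma is_upair_cases:
  assumes "is_upair u x y p" "mem z u p" "q \<le> p"
  obtains s where "s \<le> q" "eq z x s \<or> eq z y s"
  using assms unfolding is_upair_iff by (meson order.refl)

lemma is_upair_singleton:
  assumes "is_upair u x x p" "mem z u p"
  shows "eq z x p"
  by (rule regular_dense[OF regular_eq]) (use assms is_upair_cases in metis)

lemma is_upair_cong:
  assumes u: "is_upair u x y p" and eq: "eq u u' p" "eq x x' p" "eq y y' p"
  shows "is_upair u' x' y' p"
  unfolding is_upair_iff
proof (intro allI impI)
  fix z q
  assume "q \<le> p"
  have "mem z u q \<longleftrightarrow> mem z u' q"
    using mem_cong_right eq_mono[OF eq(1) \<open>q \<le> p\<close>] eq_sym by blast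
  moreover have "mem z u q \<longleftrightarrow> (\<forall>r\<le>q. \<exists>s\<le>r. eq z x s \<or> eq z y s)"
    using u \<open>q \<le> p\<close> unfolding is_upair_iff by blast
  moreover have "eq z x s \<longleftrightarrow> eq z x' s" "eq z y s \<longleftrightarrow> eq z y' s" if "s \<le> p" for s
    using that eq by (meson eq_mono eq_sym eq_trans)+
  ultimately show "mem z u' q \<longleftrightarrow> (\<forall>r\<le>q. \<exists>s\<le>r. eq z x' s \<or> eq z y' s)"
    using \<open>q \<le> p\<close> by (meson order_trans)
qed

lemma is_opairI:
  assumes "is_upair a x x p" "is_upair b x y p" "is_upair u a b p"
  shows "is_opair u x y p"
  unfolding is_opair_def
proof (rule Ex_nameI[where x = a, OF regular_Ex], rule Ex_nameI[where x = b])
  show "regular (is_upair a x x \<^bold>\<and> is_upair b x y \<^bold>\<and> is_upair u a b)"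
    by (intro regular_Conj regular_is_upair)
qed (simp add: Conj_def assms)

lemma is_opairE:
  assumes "is_opair u x y p" "q \<le> p"
  obtains a b s where "s \<le> q" "is_upair a x x s" "is_upair b x y s" "is_upair u a b s"
proof -
  obtain s a where "s \<le> q"
    and "(\<^bold>\<exists>b. is_upair a x x \<^bold>\<and> is_upair b x y \<^bold>\<and> is_upair u a b) s"
    using assms unfolding is_opair_def Ex_name_iff[of "\<lambda>a. \<^bold>\<exists>b. F a b" for F] by blast
  then obtain s' b where "s' \<le> s" and "(is_upair a x x \<^bold>\<and> is_upair b x y \<^bold>\<and> is_upair u a b) s'"
    unfolding Ex_name_iff by blast
  then show thesis
    using that \<open>s \<le> q\<close> order_trans unfolding Conj_def by blast
qed

lemma is_opair_cong:
  assumes "is_opair u x y p" "eq u u' p" "eq x x' p" "eq y y' p"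
  shows "is_opair u' x' y' p"
proof (rule regular_dense[OF regular_is_opair])
  fix q
  assume "q \<le> p"
  with assms(1) obtain a b s where s: "s \<le> q"
    and "is_upair a x x s" "is_upair b x y s" "is_upair u a b s"
    by (rule is_opairE)
  moreover have "eq u u' s" "eq x x' s" "eq y y' s"
    using assms(2-) s \<open>q \<le> p\<close> by (meson eq_mono order_trans)+
  ultimately have "is_opair u' x' y' s"
    using is_upair_cong name_eq_refl by (intro is_opairI[of a x' s b y' u']) blast+
  then show "\<exists>s\<le>q. is_opair u' x' y' s"
    using s by blast
qed

text \<open>Kuratowski's argument. Each case distinction takes place at a stronger condition, since
  a forced disjunction is decided only densely; regularity of \<open>eq\<close> brings the result
  back to \<open>p\<close>.\<close>

lemma is_opair_inject:
  assumes "is_opair u x y p" "is_opair u' x' y' p" "eq u u' p"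
  shows "eq x x' p" "eq y y' p"
proof -
  have *: "\<exists>s\<le>q. eq x x' s \<and> eq y y' s" if "q \<le> p" for q
  proof -
    obtain a b q1 where q1: "q1 \<le> q" "is_upair a x x q1" "is_upair b x y q1" "is_upair u a b q1"
      using assms(1) \<open>q \<le> p\<close> by (rule is_opairE)
    then have "q1 \<le> p"
      using \<open>q \<le> p\<close> by simp
    with assms(2) obtain a' b' s where s: "s \<le> q1"
      "is_upair a' x' x' s" "is_upair b' x' y' s" "is_upair u' a' b' s"
      by (rule is_opairE)
    have ab: "is_upair a x x r" "is_upair b x y r" "is_upair u a b r"
      "is_upair a' x' x' r" "is_upair b' x' y' r" "is_upair u' a' b' r" "eq u u' r" if "r \<le> s" for r
      using q1 s \<open>q1 \<le> p\<close> that assms(3) by (meson is_upair_mono eq_mono order_trans)+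
    \<comment> \<open>\<open>{x}\<close> equals \<open>{x'}\<close> or \<open>{x', y'}\<close>, and
      \<open>x = x'\<close> in both cases.\<close>
    have x: "eq x x' s"
    proof (rule regular_dense[OF regular_eq])
      fix r
      assume "r \<le> s"
      then have "mem a u' r"
        using mem_cong_right[OF is_upair_mem(1)[OF ab(3)] ab(7)] by blast
      then obtain r' where r': "r' \<le> r" "eq a a' r' \<or> eq a b' r'"
        using is_upair_cases[OF ab(6)] \<open>r \<le> s\<close> by blast
      then have "r' \<le> s"
        using \<open>r \<le> s\<close> by simp
      from r'(2) have "eq x x' r'"
      proof
        assume "eq a a' r'"
        then have "mem x a' r'"
          using is_upair_mem ab(1)[OF \<open>r' \<le> s\<close>] mem_cong_right by blast
        then show ?thesis
          using is_upair_singleton ab(4)[OF \<open>r' \<le> s\<close>] by blast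
      next
        assume "eq a b' r'"
        then have "mem x' a r'"
          using is_upair_mem ab(5)[OF \<open>r' \<le> s\<close>] mem_cong_right eq_sym by blast
        then show ?thesis
          using is_upair_singleton ab(1)[OF \<open>r' \<le> s\<close>] eq_sym by blast
      qed
      then show "\<exists>r'\<le>r. eq x x' r'"
        using r'(1) by blast
    qed
    \<comment> \<open>\<open>{x, y}\<close> equals \<open>{x'}\<close> or \<open>{x', y'}\<close>.
      In the latter case \<open>y = x'\<close> needs care: then \<open>y' \<in> {x, y}\<close> and
      \<open>x = x' = y\<close>. In the former case \<open>y = x'\<close>, and
      \<open>{x', y'}\<close> is compared with the elements of \<open>u\<close> in turn.\<close>
    have "mem b u' s"
      using mem_cong_right[OF is_upair_mem(2)[OF ab(3)] ab(7)] by blast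
    then obtain r where r: "r \<le> s" "eq b a' r \<or> eq b b' r"
      using is_upair_cases[OF ab(6)[OF order.refl] _ order.refl] by blast
    from r(2) have "\<exists>t\<le>r. eq y y' t"
    proof
      assume b: "eq b b' r"
      then have "mem y b' r"
        using is_upair_mem ab(2)[OF \<open>r \<le> s\<close>] mem_cong_right by blast
      then obtain r' where r': "r' \<le> r" "eq y x' r' \<or> eq y y' r'"
        using is_upair_cases[OF ab(5)] \<open>r \<le> s\<close> by blast
      from r'(2) show ?thesis
      proof
        assume y: "eq y x' r'"
        have "r' \<le> s" using r' r by simp
        then have "mem y' b r'"
          using is_upair_mem ab(5)[OF \<open>r' \<le> s\<close>] mem_cong_right b eq_sym eq_mono r'(1) by blast
        then obtain t where t: "t \<le> r'" "eq y' x t \<or> eq y' y t"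
          using is_upair_cases[OF ab(2)] \<open>r' \<le> s\<close> by blast
        then have "t \<le> s" using \<open>r' \<le> s\<close> by simp
        have "eq y' y t"
          using t(2) y x \<open>t \<le> s\<close> t(1) by (meson eq_mono eq_sym eq_trans)
        then show ?thesis
          using t(1) r'(1) eq_sym by (meson order_trans)
      qed (use r' in blast)
    next
      assume b: "eq b a' r"
      then have "mem y a' r"
        using is_upair_mem ab(2)[OF \<open>r \<le> s\<close>] mem_cong_right by blast
      then have y: "eq y x' r"
        using is_upair_singleton ab(4)[OF \<open>r \<le> s\<close>] by blast
      have "mem b' u r"
        using mem_cong_right[OF is_upair_mem(2)[OF ab(6)] eq_sym[OF ab(7)]] \<open>r \<le> s\<close> by blast
      then obtain t where t: "t \<le> r" "eq b' a t \<or> eq b' b t"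
        using is_upair_cases[OF ab(3)] \<open>r \<le> s\<close> by blast
      then have "t \<le> s" using \<open>r \<le> s\<close> by simp
      have xt: "eq x x' t" and "eq y x' t" and "eq b a' t"
        using eq_mono x y b \<open>t \<le> s\<close> t(1) by blast+
      have "mem y' b' t"
        using is_upair_mem ab(5)[OF \<open>t \<le> s\<close>] by blast
      with t(2) \<open>eq b a' t\<close> have "mem y' a t \<or> mem y' a' t"
        using mem_cong_right by blast
      then have "eq y' x t \<or> eq y' x' t"
        using is_upair_singleton ab(1,4)[OF \<open>t \<le> s\<close>] by blast
      then have "eq y y' t"
        using xt \<open>eq y x' t\<close> by (meson eq_sym eq_trans)
      then show ?thesis
        using t(1) by blast
    qed
    then obtain t where "t \<le> r" "eq y y' t"
      by blast
    moreover have "t \<le> s" using \<open>t \<le> r\<close> r(1) by simp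
    moreover have "t \<le> q" using \<open>t \<le> s\<close> s(1) q1(1) by simp
    ultimately show ?thesis
      using x eq_mono by blast
  qed
  show "eq x x' p"
  proof (rule regular_dense[OF regular_eq])
    show "\<exists>s\<le>q. eq x x' s" if "q \<le> p" for q
      using *[OF that] by auto
  qed
  show "eq y y' p"
  proof (rule regular_dense[OF regular_eq])
    show "\<exists>s\<le>q. eq y y' s" if "q \<le> p" for q
      using *[OF that] by auto
  qed
qed

definition upair_name :: "('i, 'p::order_top) name \<Rightarrow> ('i, 'p) name \<Rightarrow> ('i, 'p) name" where
  "upair_name x y = name_of {(x, top), (y, top)}"

definition opair_name :: "('i, 'p::order_top) name \<Rightarrow> ('i, 'p) name \<Rightarrow> ('i, 'p) name" where
  "opair_name x y = upair_name (upair_name x x) (upair_name x y)"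

lemma is_upair_upair_name:
  assumes "infinite (UNIV :: 'i set)"
  shows "is_upair (upair_name x y :: ('i, 'p::order_top) name) x y p"
  unfolding is_upair_iff upair_name_def mem_def dense_below_def
  by (simp add: elems_name_of_finite assms)

lemma is_opair_opair_name:
  assumes "infinite (UNIV :: 'i set)"
  shows "is_opair (opair_name x y :: ('i, 'p::order_top) name) x y p"
  unfolding opair_name_def by (rule is_opairI; rule is_upair_upair_name; rule assms)

text \<open>Of two distinct elements, the canonical name of the smaller is a member of that of the
  larger, so forced equality would yield a name that belongs to itself.\<close>

lemma check_below_eqD:
  fixes r :: "'a rel"
  assumes r: "Well_order r" "|Field r| \<le>o |UNIV :: 'i set|"
    and eq: "eq (check_below r x :: ('i, 'p::order_top) name) (check_below r y) p"
    and xy: "x \<in> Field r" "y \<in> Field r"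
  shows "x = y"
proof (rule ccontr)
  let ?c = "check_below r :: 'a \<Rightarrow> ('i, 'p) name"
  have mem: "mem (?c x) (?c y) p" if "(x, y) \<in> r - Id" for x y
    using that by (intro memI[OF _ name_eq_refl]) (auto simp: elems_check_below[OF r])
  assume "x \<noteq> y"
  then have "(x, y) \<in> r - Id \<or> (y, x) \<in> r - Id"
    using r(1) xy by (auto simp: well_order_on_def linear_order_on_def total_on_def)
  then show False
    using mem eq mem_irrefl mem_cong_right eq_sym by blast
qed

text \<open>Reduces a forced bijection to a ground-model relation: \<open>R g a p\<close> is read as
  \<open>p\<close> forcing that \<open>\<tau> g\<close> and \<open>\<beta> a\<close> correspond, and
  \<open>f\<close> names the graph. Totality and surjectivity are asked only densely, and
  surjectivity only up to forced equality, because different \<open>g\<close> may name the same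
  element.\<close>

theorem is_bijectionI:
  fixes c b f :: "('i, 'p::order_top) name"
  assumes inf: "infinite (UNIV :: 'i set)"
    and c: "elems c = {(\<tau> g, top) | g. g \<in> G}"
    and b: "elems b = {(\<beta> a, top) | a. a \<in> B}"
    and f: "elems f = {(opair_name (\<tau> g) (\<beta> a), p) | g a p. R g a p}"
    and \<beta>: "\<And>a a' p. eq (\<beta> a) (\<beta> a') p \<Longrightarrow> a \<in> B \<Longrightarrow> a' \<in> B \<Longrightarrow> a = a'"
    and dom: "\<And>g a p. R g a p \<Longrightarrow> g \<in> G \<and> a \<in> B"
    and mono: "\<And>g a p q. R g a p \<Longrightarrow> q \<le> p \<Longrightarrow> R g a q"
    and func: "\<And>g g' a p. R g a p \<Longrightarrow> R g' a p \<Longrightarrow> eq (\<tau> g) (\<tau> g') p"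
    and inj: "\<And>g g' a a' p. R g a p \<Longrightarrow> R g' a' p \<Longrightarrow> eq (\<tau> g) (\<tau> g') p \<Longrightarrow> a = a'"
    and total: "\<And>a p. a \<in> B \<Longrightarrow> \<exists>g q. q \<le> p \<and> R g a q"
    and surj: "\<And>g p. g \<in> G \<Longrightarrow> \<exists>g' a q. q \<le> p \<and> R g' a q \<and> eq (\<tau> g) (\<tau> g') q"
  shows "is_bijection f c b p"
proof -
  \<comment> \<open>An element of one of the three names is, at some stronger condition, equal to
    one of the listed names.\<close>
  have mem_f: "\<exists>s\<le>q. \<exists>g a. R g a s \<and> eq u (opair_name (\<tau> g) (\<beta> a)) s" if "mem u f q" for u q
    using memE[OF that] mono unfolding f by fastforce
  have mem_c: "\<exists>s\<le>q. \<exists>g\<in>G. eq x (\<tau> g) s" if "mem x c q" for x q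
    using memE[OF that] unfolding c by fastforce
  have mem_b: "\<exists>s\<le>q. \<exists>a\<in>B. eq x (\<beta> a) s" if "mem x b q" for x q
    using memE[OF that] unfolding b by fastforce
  have R: "mem (opair_name (\<tau> g) (\<beta> a)) f q" "mem (\<tau> g) c q" "mem (\<beta> a) b q" if "R g a q" for g a q
  proof -
    show "mem (opair_name (\<tau> g) (\<beta> a)) f q"
      by (rule memI[OF _ name_eq_refl order.refl]) (use that in \<open>auto simp: f\<close>)
    show "mem (\<tau> g) c q" "mem (\<beta> a) b q"
      by (rule memI[OF _ name_eq_refl top_greatest]; use dom[OF that] in \<open>auto simp: b c\<close>)+
  qed
  note regulars = regular_eq regular_mem regular_Conj regular_All regular_Imp regular_Ex regular_Iff
    regular_is_opair
  note opair = is_opair_opair_name[OF inf]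
  have 1: "(\<^bold>\<exists>x y. x \<^bold>\<in> c \<^bold>\<and> y \<^bold>\<in> b \<^bold>\<and> is_opair u x y) q" if m: "mem u f q" for u q
  proof (rule regular_dense[OF regular_Ex])
    fix q' assume "q' \<le> q"
    then obtain s g a where s: "s \<le> q'" "R g a s" "eq u (opair_name (\<tau> g) (\<beta> a)) s"
      using mem_f[OF mem_mono[OF m]] by blast
    have "is_opair u (\<tau> g) (\<beta> a) s"
      using is_opair_cong[OF opair eq_sym[OF s(3)] name_eq_refl name_eq_refl] .
    then have "(\<tau> g \<^bold>\<in> c \<^bold>\<and> \<beta> a \<^bold>\<in> b \<^bold>\<and> is_opair u (\<tau> g) (\<beta> a)) s"
      unfolding Conj_def using R[OF s(2)] by blast
    then have "(\<^bold>\<exists>x y. x \<^bold>\<in> c \<^bold>\<and> y \<^bold>\<in> b \<^bold>\<and> is_opair u x y) s"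
      by (intro Ex_nameI[where x = "\<tau> g", OF regular_Ex] Ex_nameI[where x = "\<beta> a"] regulars)
    then show "\<exists>s\<le>q'. (\<^bold>\<exists>x y. x \<^bold>\<in> c \<^bold>\<and> y \<^bold>\<in> b \<^bold>\<and> is_opair u x y) s"
      using s(1) by blast
  qed
  have ex: "(\<^bold>\<exists>y u. u \<^bold>\<in> f \<^bold>\<and> is_opair u x y) s" "(\<^bold>\<exists>x u. u \<^bold>\<in> f \<^bold>\<and> is_opair u x y) s"
    if "R g a s" "eq x (\<tau> g) s" "eq y (\<beta> a) s" for x y g a s
  proof -
    let ?u = "opair_name (\<tau> g) (\<beta> a)"
    have "is_opair ?u x y s"
      using is_opair_cong[OF opair name_eq_refl] that(2,3) eq_sym by blast
    then have u: "(?u \<^bold>\<in> f \<^bold>\<and> is_opair ?u x y) s"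
      unfolding Conj_def using R[OF \<open>R g a s\<close>] by blast
    have "(\<^bold>\<exists>u. u \<^bold>\<in> f \<^bold>\<and> is_opair u x y) s"
      by (rule Ex_nameI[where x = ?u], intro regulars, rule u)
    then show "(\<^bold>\<exists>y u. u \<^bold>\<in> f \<^bold>\<and> is_opair u x y) s" "(\<^bold>\<exists>x u. u \<^bold>\<in> f \<^bold>\<and> is_opair u x y) s"
      by (rule Ex_nameI[where x = y, OF regular_Ex], rule Ex_nameI[where x = x, OF regular_Ex])
  qed
  have 2: "(\<^bold>\<exists>y u. u \<^bold>\<in> f \<^bold>\<and> is_opair u x y) q" if m: "mem x c q" for x q
  proof (rule regular_dense[OF regular_Ex])
    fix q' assume "q' \<le> q"
    then obtain s g where s: "s \<le> q'" "g \<in> G" "eq x (\<tau> g) s"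
      using mem_c[OF mem_mono[OF m]] by blast
    then obtain g' a r where r: "r \<le> s" "R g' a r" "eq (\<tau> g) (\<tau> g') r"
      using surj by blast
    then have "eq x (\<tau> g') r"
      using s eq_mono eq_trans by blast
    then show "\<exists>s\<le>q'. (\<^bold>\<exists>y u. u \<^bold>\<in> f \<^bold>\<and> is_opair u x y) s"
      using ex(1)[OF r(2) _ name_eq_refl] r(1) s(1) by (meson order_trans)
  qed
  have 3: "(\<^bold>\<exists>x u. u \<^bold>\<in> f \<^bold>\<and> is_opair u x y) q" if m: "mem y b q" for y q
  proof (rule regular_dense[OF regular_Ex])
    fix q' assume "q' \<le> q"
    then obtain s a where s: "s \<le> q'" "a \<in> B" "eq y (\<beta> a) s"
      using mem_b[OF mem_mono[OF m]] by blast
    then obtain g r where r: "r \<le> s" "R g a r"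
      using total by blast
    then have "eq y (\<beta> a) r"
      using s eq_mono by blast
    then show "\<exists>s\<le>q'. (\<^bold>\<exists>x u. u \<^bold>\<in> f \<^bold>\<and> is_opair u x y) s"
      using ex(2)[OF r(2) name_eq_refl] r(1) s(1) by (meson order_trans)
  qed
  have 4: "eq x x' q \<longleftrightarrow> eq y y' q"
    if u: "mem u f q" "mem u' f q" "is_opair u x y q" "is_opair u' x' y' q" for u u' x x' y y' q
  proof -
    \<comment> \<open>Below any condition both pairs are identified with listed ones, and their
      coordinates with those of the latter. Equality of first coordinates then passes to the second
      ones by \<open>inj\<close>, and back by \<open>\<beta>\<close> and
      \<open>func\<close>.\<close>
    have "\<exists>s\<le>r. \<exists>g g' a a'. R g a s \<and> R g' a' s \<and> eq x (\<tau> g) s \<and> eq x' (\<tau> g') s \<and>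
      eq y (\<beta> a) s \<and> eq y' (\<beta> a') s" if rq: "r \<le> q" for r
    proof -
      obtain r' g a where r': "r' \<le> r" "R g a r'" "eq u (opair_name (\<tau> g) (\<beta> a)) r'"
        using mem_f[OF mem_mono[OF u(1) rq]] by blast
      then have "r' \<le> q" using rq by simp
      then obtain s g' a' where s: "s \<le> r'" "R g' a' s" "eq u' (opair_name (\<tau> g') (\<beta> a')) s"
        using mem_f[OF mem_mono[OF u(2)]] by blast
      then have "s \<le> q" using \<open>r' \<le> q\<close> by simp
      show ?thesis
        using is_opair_inject[OF is_opair_mono[OF u(3) \<open>s \<le> q\<close>] opair eq_mono[OF r'(3) s(1)]]
          is_opair_inject[OF is_opair_mono[OF u(4) \<open>s \<le> q\<close>] opair s(3)]
          mono[OF r'(2) s(1)] s(1,2) r'(1) by (meson order_trans)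
    qed
    note * = this
    show ?thesis
    proof
      assume x: "eq x x' q"
      show "eq y y' q"
      proof (rule regular_dense[OF regular_eq])
        fix r assume "r \<le> q"
        from *[OF this] obtain s g g' a a' where s: "s \<le> r" "R g a s" "R g' a' s" "eq x (\<tau> g) s"
          "eq x' (\<tau> g') s" "eq y (\<beta> a) s" "eq y' (\<beta> a') s" by blast
        have "eq x x' s" using x eq_mono s(1) \<open>r \<le> q\<close> by blast
        then have "eq (\<tau> g) (\<tau> g') s" using s(4,5) eq_trans eq_sym by blast
        then have "a = a'" using inj s by blast
        then show "\<exists>s\<le>r. eq y y' s" using s eq_trans eq_sym by blast
      qed
    next
      assume y: "eq y y' q"
      show "eq x x' q"
      proof (rule regular_dense[OF regular_eq])
        fix r assume "r \<le> q"
        from *[OF this] obtain s g g' a a' where s: "s \<le> r" "R g a s" "R g' a' s" "eq x (\<tau> g) s"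
          "eq x' (\<tau> g') s" "eq y (\<beta> a) s" "eq y' (\<beta> a') s" by blast
        have "eq y y' s" using y eq_mono s(1) \<open>r \<le> q\<close> by blast
        then have "eq (\<beta> a) (\<beta> a') s" using s(6,7) eq_trans eq_sym by blast
        then have "a = a'" using \<beta> dom s by blast
        then have "eq (\<tau> g) (\<tau> g') s" using func s by blast
        then show "\<exists>s\<le>r. eq x x' s" using s eq_trans eq_sym by blast
      qed
    qed
  qed
  \<comment> \<open>The clause for \<open>Iff\<close> quantifies over all \<open>r\<close> below the
    condition that forces the premises.\<close>
  then have 5: "eq x x' r \<longleftrightarrow> eq y y' r"
    if "mem u f q" "mem u' f q" "is_opair u x y q" "is_opair u' x' y' q" "r \<le> q"
    for u u' x x' y y' q r
    using that mem_mono is_opair_mono by blast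
  show ?thesis
    unfolding is_bijection_def
    by (simp add: Conj_def[of _ _ p] All_name_def[of _ p] Imp_iff Iff_iff regulars 1 2 3)
      (use 5 in \<open>auto simp: Conj_def\<close>)
qed

section \<open>A bijection from a generic surjection\<close>

text \<open>
  \<open>F k g p\<close> says that \<open>p\<close> forces the value at \<open>k\<close> to be \<open>\<tau> g\<close>, and \<open>D k g p\<close> that moreover this value
  is new: it occurs neither at a smaller index nor among the \<open>x k' n\<close>. The bijection maps \<open>(k, 0)\<close> to
  the value at \<open>k\<close> and \<open>(k, n + 1)\<close> to \<open>x k n\<close> if the value at \<open>k\<close> is new; otherwise it maps \<open>(k, n)\<close> to
  \<open>x k n\<close>.
\<close>

theorem generic_bijection:
  fixes \<tau> :: "'g \<Rightarrow> ('i, 'p::order) name" and F :: "'k \<Rightarrow> 'g \<Rightarrow> 'p \<Rightarrow> bool"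
    and x :: "'k \<Rightarrow> nat \<Rightarrow> 'g"
  assumes F_dom: "\<And>k g p. F k g p \<Longrightarrow> k \<in> K"
    and F_mono: "\<And>k g p q. F k g p \<Longrightarrow> q \<le> p \<Longrightarrow> F k g q"
    and F_func: "\<And>k g g' p. F k g p \<Longrightarrow> F k g' p \<Longrightarrow> g = g'"
    and F_surj: "\<And>g p. \<exists>k. \<exists>q\<le>p. F k g q"
    and x_inj: "\<And>k k' n n' p. eq (\<tau> (x k n)) (\<tau> (x k' n')) p \<Longrightarrow> k \<in> K \<Longrightarrow> k' \<in> K \<Longrightarrow> k = k' \<and> n = n'"
  obtains R where "\<And>g a p. R g a p \<Longrightarrow> a \<in> K \<times> (UNIV :: nat set)"
    and "\<And>g a p q. R g a p \<Longrightarrow> q \<le> p \<Longrightarrow> R g a q"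
    and "\<And>g g' a p. R g a p \<Longrightarrow> R g' a p \<Longrightarrow> g = g'"
    and "\<And>g g' a a' p. R g a p \<Longrightarrow> R g' a' p \<Longrightarrow> eq (\<tau> g) (\<tau> g') p \<Longrightarrow> a = a'"
    and "\<And>a p. a \<in> K \<times> UNIV \<Longrightarrow> \<exists>g q. q \<le> p \<and> R g a q"
    and "\<And>g p. \<exists>g' a q. q \<le> p \<and> R g' a q \<and> eq (\<tau> g) (\<tau> g') q"
proof -
  obtain r :: "'k rel" where r: "well_order_on UNIV r"
    using well_order_on ..
  then have wf: "wf (r - Id)"
    by (simp add: well_order_on_def)
  have total: "k = k' \<or> (k, k') \<in> r - Id \<or> (k', k) \<in> r - Id" for k k'
    using r by (auto simp: well_order_on_def linear_order_on_def total_on_def)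
  define D where "D k g p \<longleftrightarrow> F k g p \<and>
      (\<forall>k' g' q. (k', k) \<in> r - Id \<longrightarrow> q \<le> p \<longrightarrow> F k' g' q \<longrightarrow> \<not> eq (\<tau> g) (\<tau> g') q) \<and>
      (\<forall>k'\<in>K. \<forall>n. \<forall>q\<le>p. \<not> eq (\<tau> g) (\<tau> (x k' n)) q)" for k g p
  \<comment> \<open>The negative decision: no stronger condition makes the value at \<open>k\<close>
    new, be it that the value is old or that there is none. Densely, one of \<open>D\<close> and
    \<open>N\<close> holds, and they exclude each other.\<close>
  define N where "N k p \<longleftrightarrow> k \<in> K \<and> (\<forall>q\<le>p. \<forall>g. \<not> D k g q)" for k p
  define R where "R g a p \<longleftrightarrow> (case a of
      (k, 0) \<Rightarrow> D k g p \<or> N k p \<and> g = x k 0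
    | (k, Suc n) \<Rightarrow> (\<exists>g'. D k g' p) \<and> g = x k n \<or> N k p \<and> g = x k (Suc n))" for g a p
  have D_mono: "D k g q" if "D k g p" "q \<le> p" for k g p q
    using that F_mono order_trans unfolding D_def by blast
  have D_dom: "k \<in> K" if "D k g p" for k g p
    using that F_dom unfolding D_def by blast
  have N_mono: "N k q" if "N k p" "q \<le> p" for k p q
    using that order_trans unfolding N_def by blast
  have D_func: "g = g'" if "D k g p" "D k g' p" for k g g' p
    using that F_func unfolding D_def by blast
  have D_inj: "k = k'" if "D k g p" "D k' g' p" "eq (\<tau> g) (\<tau> g') p" for k k' g g' p
    using that total eq_sym order.refl unfolding D_def by meson
  have D_x: "\<not> eq (\<tau> g) (\<tau> (x k' n)) p" "\<not> eq (\<tau> (x k' n)) (\<tau> g) p" if "D k g p" "k' \<in> K" for k k' g n p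
    using that eq_sym order.refl unfolding D_def by blast+
  have DN: "\<not> N k p" if "D k g p" for k g p
    using that unfolding N_def by blast
  have decide: "\<exists>q\<le>p. (\<exists>g. D k g q) \<or> N k q" if "k \<in> K" for k p
    using that order.refl unfolding N_def by blast
  show thesis
  proof (rule that[of R])
    show "a \<in> K \<times> UNIV" if "R g a p" for g a p
      using that D_dom by (auto simp: R_def N_def split: prod.splits nat.splits)
    show "R g a q" if "R g a p" "q \<le> p" for g a p q
      using that D_mono N_mono unfolding R_def by (fastforce split: prod.splits nat.splits)
    show "g = g'" if "R g a p" "R g' a p" for g g' a p
      using that D_func DN unfolding R_def by (auto split: prod.splits nat.splits)
    show "a = a'" if R: "R g a p" "R g' a' p" and eq: "eq (\<tau> g) (\<tau> g') p" for g g' a a' p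
    proof -
      obtain k n k' n' where a: "a = (k, n)" "a' = (k', n')"
        by fastforce
      \<comment> \<open>A pair is sent either to a new value, with second entry 0, or to some
        \<open>x k m\<close>, with second entry \<open>m\<close> under \<open>N\<close> and its
        successor under \<open>D\<close>.\<close>
      have cases: "k \<in> K" "n = 0 \<and> D k g p \<or>
          (\<exists>m. g = x k m \<and> (n = Suc m \<and> (\<exists>g'. D k g' p) \<or> n = m \<and> N k p))"
        if "R g (k, n) p" for g k n
        using that D_dom unfolding R_def N_def by (auto split: nat.splits)
      note K = cases(1)[OF R(1)[unfolded a]] cases(1)[OF R(2)[unfolded a]]
      from cases(2)[OF R(1)[unfolded a]] cases(2)[OF R(2)[unfolded a]] show ?thesis
      proof (elim disjE[of "_ \<and> D _ _ _"] conjE exE)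
        assume "n = 0" "D k g p" "n' = 0" "D k' g' p"
        then show ?thesis
          using D_inj eq a by blast
      next
        fix m
        assume "D k g p" "g' = x k' m"
        then show ?thesis
          using D_x(1) K(2) eq by blast
      next
        fix m
        assume "D k' g' p" "g = x k m"
        then show ?thesis
          using D_x(2) K(1) eq by blast
      next
        fix m m'
        assume *: "g = x k m" "g' = x k' m'" "n = Suc m \<and> (\<exists>g'. D k g' p) \<or> n = m \<and> N k p"
          "n' = Suc m' \<and> (\<exists>g'. D k' g' p) \<or> n' = m' \<and> N k' p"
        then have "k = k'" "m = m'"
          using x_inj[OF _ K] eq by blast+
        then show ?thesis
          using *(3,4) DN unfolding a by blast
      qed
    qed
    show "\<exists>g q. q \<le> p \<and> R g a q" if "a \<in> K \<times> UNIV" for a p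
    proof -
      obtain k n where a: "a = (k, n)" "k \<in> K"
        using \<open>a \<in> K \<times> UNIV\<close> by blast
      obtain q where q: "q \<le> p" "(\<exists>g. D k g q) \<or> N k q"
        using decide[OF a(2)] by blast
      then show ?thesis
        unfolding a(1) R_def by (cases n) auto
    qed
    show "\<exists>g' a q. q \<le> p \<and> R g' a q \<and> eq (\<tau> g) (\<tau> g') q" for g p
    proof (cases "\<exists>k\<in>K. \<exists>n. \<exists>q\<le>p. eq (\<tau> g) (\<tau> (x k n)) q")
      case True
      then obtain k n q where k: "k \<in> K" "q \<le> p" "eq (\<tau> g) (\<tau> (x k n)) q"
        by blast
      then obtain s where s: "s \<le> q" "(\<exists>g. D k g s) \<or> N k s"
        using decide by blast
      \<comment> \<open>Where the value at \<open>k\<close> is new, it occupies index 0 and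
        \<open>x k n\<close> has moved up by one.\<close>
      have "R (x k n) (k, if N k s then n else Suc n) s"
        using s(2) unfolding R_def by (auto split: nat.splits)
      moreover have "eq (\<tau> g) (\<tau> (x k n)) s"
        using k(3) s(1) eq_mono by blast
      ultimately show ?thesis
        using s(1) k(2) order_trans by blast
    next
      case False
      \<comment> \<open>Now \<open>g\<close> stays different from all \<open>x k n\<close> below
        \<open>p\<close>. The least index that can still take a value equal to \<open>g\<close>
        takes it as a new value: minimality excludes the smaller indices below
        \<open>q\<close>.\<close>
      define A where "A = {k. \<exists>q\<le>p. \<exists>g'. F k g' q \<and> eq (\<tau> g) (\<tau> g') q}"
      have "A \<noteq> {}"
        using F_surj name_eq_refl unfolding A_def by blast
      then obtain k where k: "k \<in> A" "\<And>k'. (k', k) \<in> r - Id \<Longrightarrow> k' \<notin> A"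
        using wf by (metis ex_in_conv wfE_min)
      then obtain q g' where q: "q \<le> p" "F k g' q" "eq (\<tau> g) (\<tau> g') q"
        unfolding A_def by blast
      have "D k g' q"
        unfolding D_def
      proof (intro conjI allI impI ballI notI)
        show "F k g' q" by (rule q)
      next
        fix k' g'' s
        assume *: "(k', k) \<in> r - Id" "s \<le> q" "F k' g'' s" "eq (\<tau> g') (\<tau> g'') s"
        then have "eq (\<tau> g) (\<tau> g'') s"
          using q(3) eq_mono eq_trans by blast
        moreover have "s \<le> p"
          using * q(1) by simp
        ultimately show False
          using k(2)[OF *(1)] *(3) unfolding A_def by blast
      next
        fix k' n s
        assume *: "k' \<in> K" "s \<le> q" "eq (\<tau> g') (\<tau> (x k' n)) s"
        then have "eq (\<tau> g) (\<tau> (x k' n)) s"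
          using q(3) eq_mono eq_trans by blast
        then show False
          using False * q(1) order_trans by blast
      qed
      then have "R g' (k, 0) q"
        unfolding R_def by simp
      then show ?thesis
        using q by blast
    qed
  qed
qed


section \<open>Miller trees\<close>

definition split_node :: "miller \<Rightarrow> nat list \<Rightarrow> bool" where
  "split_node p t \<longleftrightarrow> t \<in> tree p \<and> infinite {n. t @ [n] \<in> tree p}"

lemma miller_tree_tree: "miller_tree (tree p)"
  using tree by simp

lemma tree_prefix: "t \<in> tree p \<Longrightarrow> prefix s t \<Longrightarrow> s \<in> tree p"
  using miller_tree_tree unfolding miller_tree_def by blast

lemma ex_split_node:
  assumes "t \<in> tree p"
  obtains s where "prefix t s" "split_node p s"
  using assms miller_tree_tree unfolding miller_tree_def split_node_def by blast

lemma split_node_succ: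
  assumes "split_node p t"
  obtains n where "n \<ge> m" "t @ [n] \<in> tree p"
  using assms unfolding split_node_def infinite_nat_iff_unbounded_le by blast

lemma ex_longer_split_node:
  assumes "t \<in> tree p"
  obtains s where "strict_prefix t s" "split_node p s"
proof -
  obtain s where s: "prefix t s" "split_node p s"
    using assms by (rule ex_split_node)
  then obtain n where "s @ [n] \<in> tree p"
    by (blast elim: split_node_succ)
  then obtain s' where "prefix (s @ [n]) s'" "split_node p s'"
    by (rule ex_split_node)
  then show thesis
    using that s(1) by (meson append_one_prefix prefix_order.le_less_trans prefix_snoc
        prefix_order.less_le_trans strict_prefixI' prefix_order.dual_order.strict_trans2)
qed

lemma Nil_in_tree: "[] \<in> tree p"
  using miller_tree_tree[of p] Nil_prefix unfolding miller_tree_def by blast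

lemma ex_long_split_node: "\<exists>s. split_node p s \<and> k \<le> length s"
proof (induction k)
  case 0
  then show ?case
    using ex_split_node[OF Nil_in_tree] by blast
next
  case (Suc k)
  then obtain s where "split_node p s" "k \<le> length s"
    by blast
  moreover obtain s' where "strict_prefix s s'" "split_node p s'"
    using ex_longer_split_node calculation(1) unfolding split_node_def by blast
  ultimately show ?case
    using prefix_length_less by fastforce
qed

section \<open>Restriction to a node and fusion\<close>

definition restrict_tree :: "miller \<Rightarrow> nat list \<Rightarrow> miller" where
  "restrict_tree p t = Miller {u \<in> tree p. prefix u t \<or> prefix t u}"

lemma tree_restrict_tree:
  assumes "t \<in> tree p"
  shows "tree (restrict_tree p t) = {u \<in> tree p. prefix u t \<or> prefix t u}"
proof -
  have "miller_tree {u \<in> tree p. prefix u t \<or> prefix t u}" (is "miller_tree ?T")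
    unfolding miller_tree_def
  proof (intro conjI ballI allI impI)
    show "?T \<noteq> {}"
      using assms by blast
    show "s \<in> ?T" if "u \<in> ?T" "prefix s u" for s u
      using that tree_prefix by (auto dest: prefix_order.trans prefix_same_cases)
    show "\<exists>s\<in>?T. prefix u s \<and> infinite {n. s @ [n] \<in> ?T}" if "u \<in> ?T" for u
    proof -
      obtain v where v: "prefix u v" "prefix t v" "v \<in> tree p"
        using \<open>u \<in> ?T\<close> assms by auto
      then obtain s where s: "prefix v s" "split_node p s"
        using ex_split_node by blast
      then have "prefix t s" "prefix u s"
        using v prefix_order.trans by blast+
      then have "{n. s @ [n] \<in> ?T} = {n. s @ [n] \<in> tree p}"
        by auto
      then show ?thesis
        using s \<open>prefix t s\<close> \<open>prefix u s\<close> unfolding split_node_def by (intro bexI[of _ s]) auto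
    qed
  qed
  then show ?thesis
    unfolding restrict_tree_def by (simp add: Miller_inverse)
qed

lemma restrict_tree_le: "t \<in> tree p \<Longrightarrow> restrict_tree p t \<le> p"
  by (auto simp: less_eq_miller_def tree_restrict_tree)

text \<open>All nodes of \<open>q\<close> are comparable with \<open>t\<close>, so a proper initial
  segment of \<open>t\<close> has at most one successor in \<open>q\<close>, the one along
  \<open>t\<close>, and does not split.\<close>

lemma split_node_restrict_tree:
  assumes "t \<in> tree p" "q \<le> restrict_tree p t" "split_node q s"
  shows "prefix t s"
proof (rule ccontr)
  assume "\<not> prefix t s"
  have comp: "prefix u t \<or> prefix t u" if "u \<in> tree q" for u
    using assms(1,2) that by (auto simp: less_eq_miller_def tree_restrict_tree)
  then have "prefix s t"
    using assms(3) \<open>\<not> prefix t s\<close> by (auto simp: split_node_def)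
  with \<open>\<not> prefix t s\<close> obtain m v where t: "t = s @ m # v"
    by (metis append_Nil2 neq_Nil_conv prefix_def prefix_order.refl)
  obtain n where n: "n \<ge> Suc m" "s @ [n] \<in> tree q"
    using assms(3) by (rule split_node_succ)
  then show False
    using comp[of "s @ [n]"] by (auto simp: t)
qed

text \<open>Fusion: the splitting nodes \<open>t \<sigma>\<close> of \<open>q\<close> are arranged
  like the finite sequences, and above \<open>t \<sigma>\<close> the tree \<open>q\<close> stays
  inside \<open>P \<sigma>\<close>, which lies in the dense set of index
  \<open>length \<sigma>\<close>. So each of countably many questions is answered below
  \<open>q\<close> by one of countably many conditions, and these can be coded by a single
  real.\<close>

theorem miller_fusion:
  fixes p :: miller
  assumes dense: "\<And>k p. \<exists>q\<le>p. D k (q :: miller)"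
  obtains q P where "q \<le> p" "\<And>\<sigma>. D (length \<sigma>) (P \<sigma>)"
    and "\<And>k r. r \<le> q \<Longrightarrow> \<exists>\<sigma>::nat list. length \<sigma> = k \<and> (\<exists>s\<le>r. s \<le> P \<sigma>)"
proof -
  define pick where "pick k r = (SOME q. q \<le> r \<and> D k q)" for k r
  have pick: "pick k r \<le> r" "D k (pick k r)" for k r
    using someI_ex[OF dense[of r k]] by (simp_all add: pick_def)
  define sp where "sp S = (SOME t. split_node S t)" for S
  have sp: "split_node S (sp S)" for S
    unfolding sp_def by (rule someI_ex) (use ex_long_split_node in blast)
  define e where "e S = enumerate {n. sp S @ [n] \<in> tree S}" for S
  have e: "sp S @ [e S n] \<in> tree S" "inj (e S)" for S n
    using sp[of S] enumerate_in_set[of "{n. sp S @ [n] \<in> tree S}" n]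
      strict_mono_enumerate[of "{n. sp S @ [n] \<in> tree S}"]
    by (auto simp: e_def split_node_def strict_mono_imp_inj_on)
  \<comment> \<open>The recursion runs over \<open>rev \<sigma>\<close> because a child appends its
    entry at the end. The bound \<open>\<sigma>\<close> is the reversed parent, of which only the
    length enters.\<close>
  define P where "P \<sigma> = rec_list (pick 0 p)
    (\<lambda>n \<sigma> S. pick (Suc (length \<sigma>)) (restrict_tree S (sp S @ [e S n]))) (rev \<sigma>)" for \<sigma>
  define t where "t \<sigma> = sp (P \<sigma>)" for \<sigma>
  define c where "c \<sigma> n = t \<sigma> @ [e (P \<sigma>) n]" for \<sigma> n
  have P: "P [] = pick 0 p" "P (\<sigma> @ [n]) = pick (Suc (length \<sigma>)) (restrict_tree (P \<sigma>) (c \<sigma> n))" for \<sigma> n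
    by (simp_all add: P_def c_def t_def)
  have t_split: "split_node (P \<sigma>) (t \<sigma>)" and c_in: "c \<sigma> n \<in> tree (P \<sigma>)" for \<sigma> n
    by (simp_all add: t_def c_def sp e)
  then have t_in: "t \<sigma> \<in> tree (P \<sigma>)" for \<sigma>
    by (simp add: split_node_def)
  have D: "D (length \<sigma>) (P \<sigma>)" for \<sigma>
    by (cases \<sigma> rule: rev_cases) (simp_all add: P pick(2))
  have c_prefix: "prefix (c \<sigma> n) (t (\<sigma> @ [n]))" for \<sigma> n
    using split_node_restrict_tree[OF c_in _ t_split] by (simp add: P pick(1))
  have P_Suc: "P (\<sigma> @ [n]) \<le> P \<sigma>" for \<sigma> n
    using pick(1) restrict_tree_le[OF c_in] order_trans unfolding P by blast
  have P_mono: "P \<rho> \<le> P \<sigma>" if "prefix \<sigma> \<rho>" for \<sigma> \<rho>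
    using that by (induction \<rho> rule: rev_induct) (auto simp: prefix_snoc intro: order_trans P_Suc)
  have t_c: "prefix (t \<sigma>) (c \<sigma> n)" for \<sigma> n
    by (simp add: c_def)
  have t_mono: "prefix (t \<sigma>) (t \<rho>)" if "prefix \<sigma> \<rho>" for \<sigma> \<rho>
    using that
  proof (induction \<rho> rule: rev_induct)
    case (snoc n \<rho>)
    then show ?case
      using t_c c_prefix prefix_order.trans by (metis prefix_snoc prefix_order.refl)
  qed auto
  have c_t: "prefix (c \<sigma> n) (t (\<sigma> @ n # \<rho>))" for \<sigma> n \<rho>
    using c_prefix[of \<sigma> n] t_mono[of "\<sigma> @ [n]" "\<sigma> @ n # \<rho>"] prefix_order.trans by fastforce
  have c_inj: "n = m" if "prefix (c \<sigma> n) u" "prefix (c \<sigma> m) u" for \<sigma> n m u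
    using prefix_same_cases[OF that] e(2)[of "P \<sigma>"] by (auto simp: c_def inj_eq)
  \<comment> \<open>Otherwise either \<open>\<rho>\<close> is a proper initial segment of
    \<open>\<sigma>\<close> and \<open>t \<sigma>\<close> is longer than \<open>t \<rho>\<close>, or
    the sequences part at some \<open>\<omega>\<close> and their nodes pass through different
    successors of \<open>t \<omega>\<close>.\<close>
  have t_prefix: "prefix \<sigma> \<rho>" if "prefix (t \<sigma>) (t \<rho>)" for \<sigma> \<rho>
  proof (rule ccontr)
    assume np: "\<not> prefix \<sigma> \<rho>"
    show False
    proof (cases "prefix \<rho> \<sigma>")
      case True
      with np obtain n \<tau> where \<sigma>: "\<sigma> = \<rho> @ n # \<tau>"
        by (metis append_Nil2 neq_Nil_conv prefix_def prefix_order.refl)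
      then have "prefix (c \<rho> n) (t \<rho>)"
        using c_t that prefix_order.trans by blast
      then show False
        using prefix_length_le by (fastforce simp: c_def)
    next
      case False
      with np obtain \<omega> n m \<tau> \<tau>' where "n \<noteq> m" "\<sigma> = \<omega> @ n # \<tau>" "\<rho> = \<omega> @ m # \<tau>'"
        using parallel_decomp[of \<sigma> \<rho>] by (auto simp: parallel_def)
      then show False
        using c_t c_inj that prefix_order.trans by blast
    qed
  qed
  have "miller_tree {u. \<exists>\<sigma>. prefix u (t \<sigma>)}" (is "miller_tree ?Q")
    unfolding miller_tree_def
  proof (intro conjI ballI allI impI)
    show "s \<in> ?Q" if "u \<in> ?Q" "prefix s u" for s u
      using that prefix_order.trans by blast
    show "\<exists>s\<in>?Q. prefix u s \<and> infinite {n. s @ [n] \<in> ?Q}" if "u \<in> ?Q" for u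
    proof -
      obtain \<sigma> where \<sigma>: "prefix u (t \<sigma>)"
        using \<open>u \<in> ?Q\<close> by blast
      have "range (e (P \<sigma>)) \<subseteq> {n. t \<sigma> @ [n] \<in> ?Q}"
        using c_prefix unfolding c_def by blast
      then have "infinite {n. t \<sigma> @ [n] \<in> ?Q}"
        using range_inj_infinite[OF e(2)] infinite_super by blast
      with \<sigma> show ?thesis
        by blast
    qed
  qed blast
  then have tree_q: "tree (Miller ?Q) = ?Q"
    by (simp add: Miller_inverse)
  define q where "q = Miller ?Q"
  have "q \<le> P []"
    using t_in P_mono[OF Nil_prefix] tree_prefix unfolding less_eq_miller_def q_def tree_q by blast
  then have "q \<le> p"
    using pick(1) order_trans unfolding P by blast
  \<comment> \<open>Two successors of \<open>v\<close> lie below some \<open>t \<rho>\<close> and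
    \<open>t \<rho>'\<close>. If \<open>\<rho>\<close> and \<open>\<rho>'\<close> part at
    \<open>\<omega>\<close>, these nodes part exactly at \<open>t \<omega>\<close>, so
    \<open>v\<close> can be neither shorter nor longer.\<close>
  have split_q: "\<exists>\<omega>. v = t \<omega>" if "split_node r v" "r \<le> q" for r v
  proof -
    obtain m where m: "v @ [m] \<in> tree r"
      using \<open>split_node r v\<close> by (rule split_node_succ)
    obtain m' where m': "v @ [m'] \<in> tree r" "m' \<ge> Suc m"
      using \<open>split_node r v\<close> by (rule split_node_succ)
    obtain \<rho> \<rho>' where \<rho>: "prefix (v @ [m]) (t \<rho>)" "prefix (v @ [m']) (t \<rho>')"
      using m m' \<open>r \<le> q\<close> unfolding less_eq_miller_def q_def tree_q by blast
    have diff: "\<not> (prefix (v @ [m]) u \<and> prefix (v @ [m']) u)" for u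
      using prefix_same_cases[of "v @ [m]" u "v @ [m']"] m'(2) by auto
    have "\<not> prefix \<rho> \<rho>'" "\<not> prefix \<rho>' \<rho>"
      using diff \<rho> t_mono prefix_order.trans by blast+
    then obtain \<omega> n n' \<tau> \<tau>' where n: "n \<noteq> n'" "\<rho> = \<omega> @ n # \<tau>" "\<rho>' = \<omega> @ n' # \<tau>'"
      using parallel_decomp[of \<rho> \<rho>'] by (auto simp: parallel_def)
    then have c: "prefix (c \<omega> n) (t \<rho>)" "prefix (c \<omega> n') (t \<rho>')"
      using c_t by blast+
    have "v = t \<omega>"
    proof (rule ccontr)
      assume "v \<noteq> t \<omega>"
      consider "length v < length (t \<omega>)" | "length (t \<omega>) < length v" | "length v = length (t \<omega>)"
        by linarith
      then show False
      proof cases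
        case 1
        have "prefix (t \<omega>) (t \<rho>)" "prefix (t \<omega>) (t \<rho>')"
          using c t_c prefix_order.trans by blast+
        then have "prefix (v @ [m]) (t \<omega>)" "prefix (v @ [m']) (t \<omega>)"
          using 1 \<rho> by (auto intro: prefix_length_prefix)
        then show False
          using diff by blast
      next
        case 2
        have "prefix v (t \<rho>)" "prefix v (t \<rho>')"
          using \<rho> append_prefixD by blast+
        then have "prefix (c \<omega> n) v" "prefix (c \<omega> n') v"
          using 2 c by (auto simp: c_def intro: prefix_length_prefix)
        then show False
          using c_inj n(1) by blast
      next
        case 3
        have "prefix v (t \<rho>)" "prefix (t \<omega>) (t \<rho>)"
          using \<rho> c append_prefixD unfolding c_def by blast+
        then show False
          using 3 \<open>v \<noteq> t \<omega>\<close> by (metis prefix_length_prefix prefix_order.eq_iff order.refl)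
      qed
    qed
    then show ?thesis ..
  qed
  have long: "\<exists>\<omega>. split_node r (t \<omega>) \<and> k \<le> length \<omega>" if r: "r \<le> q" for r k
  proof (induction k)
    case 0
    then show ?case
      using ex_split_node[OF Nil_in_tree] split_q[OF _ r] by (metis le0)
  next
    case (Suc k)
    then obtain \<omega> where \<omega>: "split_node r (t \<omega>)" "k \<le> length \<omega>"
      by blast
    then obtain v where v: "strict_prefix (t \<omega>) v" "split_node r v"
      using ex_longer_split_node unfolding split_node_def by blast
    then obtain \<omega>' where "v = t \<omega>'"
      using split_q r by blast
    with v(1) t_prefix[of \<omega> \<omega>'] have "strict_prefix \<omega> \<omega>'"
      by (auto simp: strict_prefix_def)
    then show ?case
      using \<omega>(2) v(2) \<open>v = t \<omega>'\<close> prefix_length_less by fastforce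
  qed
  have "\<exists>\<sigma>. length \<sigma> = k \<and> (\<exists>s\<le>r. s \<le> P \<sigma>)" if r: "r \<le> q" for r k
  proof -
    obtain \<omega> where \<omega>: "split_node r (t \<omega>)" "k \<le> length \<omega>"
      using long[OF r] by blast
    \<comment> \<open>A splitting node of \<open>r\<close> deep in the arrangement passes through
      \<open>t \<sigma>\<close> for the initial segment of length \<open>k\<close>.\<close>
    define \<sigma> where "\<sigma> = take k \<omega>"
    have \<sigma>: "t \<sigma> \<in> tree r"
      using \<omega>(1) t_mono[of \<sigma> \<omega>] tree_prefix unfolding \<sigma>_def split_node_def
      by (metis take_is_prefix)
    \<comment> \<open>A node of \<open>r\<close> above \<open>t \<sigma>\<close> lies below some
      \<open>t \<rho>\<close>; then \<open>\<rho>\<close> extends \<open>\<sigma>\<close>, and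
      \<open>t \<rho>\<close> belongs to \<open>P \<rho> \<le> P \<sigma>\<close>.\<close>
    have "restrict_tree r (t \<sigma>) \<le> P \<sigma>"
      unfolding less_eq_miller_def tree_restrict_tree[OF \<sigma>]
    proof safe
      fix u
      assume "u \<in> tree r" "prefix u (t \<sigma>)"
      then show "u \<in> tree (P \<sigma>)"
        using t_in tree_prefix by blast
    next
      fix u
      assume u: "u \<in> tree r" "prefix (t \<sigma>) u"
      then obtain \<rho> where \<rho>: "prefix u (t \<rho>)"
        using r unfolding less_eq_miller_def q_def tree_q by blast
      then have "P \<rho> \<le> P \<sigma>"
        using u(2) t_prefix P_mono prefix_order.trans by blast
      then show "u \<in> tree (P \<sigma>)"
        using \<rho> t_in tree_prefix unfolding less_eq_miller_def by blast
    qed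
    then show ?thesis
      using restrict_tree_le[OF \<sigma>] \<omega>(2) by (intro exI[of _ \<sigma>]) (auto simp: \<sigma>_def)
  qed
  then show thesis
    using that \<open>q \<le> p\<close> D by blast
qed


section \<open>Sparse sets and almost disjoint unions of blocks\<close>

text \<open>Each element is taken beyond the bound of its predecessor; as the bound covers all
  larger numbers, every later element satisfies it too.\<close>

lemma ex_sparse_set:
  fixes P :: "nat \<Rightarrow> nat \<Rightarrow> bool"
  assumes "\<And>a. \<exists>b. \<forall>c\<ge>b. P a c"
  shows "\<exists>Y. infinite Y \<and> (\<forall>a\<in>Y. \<forall>b\<in>Y. a < b \<longrightarrow> P a b)"
proof -
  obtain f where f: "P a c" if "f a \<le> c" for a c
    using assms by metis
  define y where "y = rec_nat 0 (\<lambda>_ a. max (Suc a) (f a))"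
  have y_Suc: "y (Suc k) = max (Suc (y k)) (f (y k))" for k
    by (simp add: y_def)
  then have "strict_mono y"
    by (simp add: strict_mono_Suc_iff less_max_iff_disj)
  show ?thesis
  proof (intro exI[of _ "range y"] conjI ballI impI)
    show "infinite (range y)"
      using \<open>strict_mono y\<close> range_inj_infinite strict_mono_imp_inj_on by blast
    show "P a b" if ab: "a \<in> range y" "b \<in> range y" "a < b" for a b
    proof -
      obtain i j where ij: "a = y i" "b = y j"
        using ab by blast
      then have "Suc i \<le> j"
        using ab \<open>strict_mono y\<close> by (simp add: strict_mono_less)
      then have "y (Suc i) \<le> b"
        using ij \<open>strict_mono y\<close> by (simp add: strict_mono_less_eq)
      then show ?thesis
        using f ij y_Suc by simp
    qed
  qed
qed

abbreviation block :: "nat set \<Rightarrow> nat \<Rightarrow> nat set" where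
  "block X k \<equiv> {enumerate X k..<enumerate X (k + 1)}"

lemma block_disjoint:
  assumes "infinite X" "x \<in> block X k" "x \<in> block X l"
  shows "k = l"
proof -
  have "\<not> k < l" if "x \<in> block X k" "x \<in> block X l" for k l
  proof
    assume "k < l"
    then have "enumerate X (k + 1) \<le> enumerate X l"
      using assms(1) by (simp add: enumerate_mono_le_iff)
    then show False
      using that by simp
  qed
  then show ?thesis
    using assms by (meson nat_neq_iff)
qed

lemma two_in_block:
  fixes Y :: "nat set"
  assumes "card (block X k \<inter> Y) \<ge> 2"
  obtains a b where "a < b" "a \<in> Y" "b \<in> Y" "a \<in> block X k" "b \<in> block X k"
proof -
  have "\<not> card (block X k \<inter> Y) \<le> Suc 0"
    using assms by simp
  then obtain a b where "a \<noteq> b" "a \<in> block X k \<inter> Y" "b \<in> block X k \<inter> Y"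
    using card_le_Suc0_iff_eq[of "block X k \<inter> Y"] by blast
  then show thesis
    using that[of a b] that[of b a] by (cases "a < b") auto
qed

text \<open>Against a finite \<open>F\<close> there is a \<open>Y\<close> so sparse that every
  \<open>X\<close> in \<open>F\<close> has a point between any two elements of \<open>Y\<close>;
  then no block of \<open>X\<close> contains two of them. Infinity makes products of
  \<open>F\<close> with countable sets as large as \<open>F\<close>.\<close>

lemma weakly_dominating_infinite:
  assumes F: "weakly_dominating F"
  shows "infinite F"
proof
  assume fin: "finite F"
  have "\<exists>b. \<forall>c\<ge>b. \<forall>X\<in>F. \<exists>x\<in>X. a < x \<and> x \<le> c" for a
  proof -
    have "\<exists>x\<in>X. a < x" if "X \<in> F" for X
      using F that unfolding weakly_dominating_def infinite_nat_iff_unbounded by blast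
    then obtain f where f: "f X \<in> X" "a < f X" if "X \<in> F" for X
      by metis
    have "f X \<le> Max (f ` F)" if "X \<in> F" for X
      using fin that by simp
    then show ?thesis
      using f order_trans by blast
  qed
  then have "\<exists>Y. infinite Y \<and> (\<forall>a\<in>Y. \<forall>b\<in>Y. a < b \<longrightarrow> (\<forall>X\<in>F. \<exists>x\<in>X. a < x \<and> x \<le> b))"
    by (rule ex_sparse_set)
  then obtain Y where Y: "infinite Y"
    "\<forall>a\<in>Y. \<forall>b\<in>Y. a < b \<longrightarrow> (\<forall>X\<in>F. \<exists>x\<in>X. a < x \<and> x \<le> b)"
    by blast
  then obtain X where X: "X \<in> F" "INFM i. \<forall>j<2 ^ i. card (block X (2 ^ i + j) \<inter> Y) \<ge> 2"
    using F unfolding weakly_dominating_def by blast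
  obtain i where "\<forall>j<2 ^ i. card (block X (2 ^ i + j) \<inter> Y) \<ge> 2"
    using INFM_EX[OF X(2)] by blast
  then have "card (block X (2 ^ i) \<inter> Y) \<ge> 2"
    by (metis add.right_neutral zero_less_numeral zero_less_power)
  then obtain a b where ab: "a < b" "a \<in> Y" "b \<in> Y" "a \<in> block X (2 ^ i)" "b \<in> block X (2 ^ i)"
    by (rule two_in_block)
  then obtain x where x: "x \<in> X" "a < x" "x \<le> b"
    using Y(2) X(1) by blast
  have "infinite X"
    using F X(1) unfolding weakly_dominating_def by blast
  then obtain l where l: "x = enumerate X l"
    using x(1) enumerate_Ex by metis
  then have "x \<in> block X l"
    using \<open>infinite X\<close> by (simp add: enumerate_mono)
  \<comment> \<open>The left end is the only element of \<open>X\<close> in its block, but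
    \<open>x\<close> lies to the right of \<open>a\<close>.\<close>
  moreover have "x \<in> block X (2 ^ i)"
    using x ab by auto
  ultimately have "l = 2 ^ i"
    using block_disjoint \<open>infinite X\<close> by blast
  then show False
    using l x(2) ab(4) by simp
qed

definition branch_set :: "nat set \<Rightarrow> nat set \<Rightarrow> nat set" where
  "branch_set X g = (\<Union>i. block X (2 ^ i + set_encode (g \<inter> {..<i})))"

lemma set_encode_less: "set_encode (g \<inter> {..<i}) < 2 ^ i"
proof (induction i)
  case (Suc i)
  have "g \<inter> {..<Suc i} = (if i \<in> g then insert i (g \<inter> {..<i}) else g \<inter> {..<i})"
    by (auto simp: less_Suc_eq)
  then show ?case
    using Suc by simp
qed simp

text \<open>The indices of level \<open>i\<close> fill the interval from \<open>2 ^ i\<close> up to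
  but excluding \<open>2 ^ (i + 1)\<close>, so the levels do not overlap.\<close>

lemma dyadic_index_unique:
  fixes j j' :: nat
  assumes "2 ^ i + j = 2 ^ i' + j'" "j < 2 ^ i" "j' < 2 ^ i'"
  shows "i = i'"
proof -
  have "\<not> i < i'" if "2 ^ i + j = 2 ^ i' + j'" "j < 2 ^ i" for i i' j j' :: nat
  proof
    assume "i < i'"
    then have "2 ^ Suc i \<le> (2 :: nat) ^ i'"
      by (intro power_increasing) auto
    then show False
      using that by simp
  qed
  then show ?thesis
    using assms by (metis nat_neq_iff)
qed

text \<open>A common point lies in a single block, whose index determines the level \<open>i\<close>
  and the digits below \<open>i\<close>. So \<open>g\<close> and \<open>g'\<close> agree below
  \<open>i\<close>, and \<open>i\<close> is at most any place \<open>n\<close> where they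
  differ.\<close>

lemma finite_branch_set_Int:
  assumes X: "infinite X" and "g \<noteq> g'"
  shows "finite (branch_set X g \<inter> branch_set X g')"
proof -
  obtain n where n: "n \<in> g \<longleftrightarrow> n \<notin> g'"
    using \<open>g \<noteq> g'\<close> by blast
  have "branch_set X g \<inter> branch_set X g' \<subseteq> (\<Union>i\<le>n. block X (2 ^ i + set_encode (g \<inter> {..<i})))"
  proof
    fix x
    assume "x \<in> branch_set X g \<inter> branch_set X g'"
    then obtain i i' where x: "x \<in> block X (2 ^ i + set_encode (g \<inter> {..<i}))"
      and x': "x \<in> block X (2 ^ i' + set_encode (g' \<inter> {..<i'}))"
      unfolding branch_set_def by blast
    have *: "2 ^ i + set_encode (g \<inter> {..<i}) = 2 ^ i' + set_encode (g' \<inter> {..<i'})"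
      by (rule block_disjoint[OF X x x'])
    then have "i = i'"
      by (rule dyadic_index_unique) (rule set_encode_less)+
    with * have "g \<inter> {..<i} = g' \<inter> {..<i}"
      by (simp add: set_encode_eq)
    then have "i \<le> n"
      using n by (metis Int_iff lessThan_iff not_le)
    with x show "x \<in> (\<Union>i\<le>n. block X (2 ^ i + set_encode (g \<inter> {..<i})))"
      by blast
  qed
  then show ?thesis
    by (rule finite_subset) simp
qed

lemma infinite_branch_set:
  assumes X: "infinite X"
  shows "infinite (branch_set X g)"
  unfolding infinite_nat_iff_unbounded_le
proof
  fix m
  let ?k = "2 ^ m + set_encode (g \<inter> {..<m})"
  have "m \<le> ?k"
    by (metis less_exp less_imp_le trans_le_add1)
  also have "?k \<le> enumerate X ?k"
    by (rule le_enumerate[OF X])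
  finally show "\<exists>n\<ge>m. n \<in> branch_set X g"
    using X by (intro exI[of _ "enumerate X ?k"]) (auto simp: branch_set_def enumerate_mono intro!: exI[of _ m])
qed

section \<open>The trees attached to \<open>(X, s)\<close> and \<open>g\<close>\<close>

text \<open>The weight bounds both length and entries, so only finitely many sequences lie below a
  given weight, while the successors of a node in the full tree realise every larger weight exactly
  once.\<close>

definition weight :: "nat list \<Rightarrow> nat" where
  "weight u = length u + sum_list u"

lemma weight_snoc [simp]: "weight (u @ [n]) = weight u + n + 1"
  by (simp add: weight_def)

lemma weight_mono: "prefix u v \<Longrightarrow> weight u \<le> weight v"
  by (auto simp: weight_def prefix_def)

lemma finite_weight_less: "finite {u. weight u < k}"
proof (rule finite_subset)
  show "{u. weight u < k} \<subseteq> {u. set u \<subseteq> {..<k} \<and> length u \<le> k}"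
    by (auto simp: weight_def dest!: member_le_sum_list)
qed (simp add: finite_lists_length_le)

definition branch_nodes :: "nat set \<Rightarrow> nat list \<Rightarrow> nat set \<Rightarrow> nat list set" where
  "branch_nodes X s g = {u. prefix u s \<or>
     prefix s u \<and> (\<forall>v. prefix v u \<longrightarrow> strict_prefix s v \<longrightarrow> weight v \<in> branch_set X g)}"

text \<open>Every node of the tree from \<open>s\<close> on splits, since its possible successors
  realise all larger weights and infinitely many of these are in the branch set.\<close>

lemma miller_tree_branch_nodes:
  assumes "infinite X"
  shows "miller_tree (branch_nodes X s g)" (is "miller_tree ?T")
  unfolding miller_tree_def
proof (intro conjI ballI allI impI)
  show "?T \<noteq> {}"
    unfolding branch_nodes_def by blast
  show "w \<in> ?T" if "u \<in> ?T" "prefix w u" for u w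
    using that prefix_same_cases[of w u s] prefix_order.trans unfolding branch_nodes_def by blast
  show "\<exists>v\<in>?T. prefix u v \<and> infinite {n. v @ [n] \<in> ?T}" if "u \<in> ?T" for u
  proof -
    obtain v where v: "v \<in> ?T" "prefix u v" "prefix s v"
      using \<open>u \<in> ?T\<close> unfolding branch_nodes_def by blast
    have in_T: "v @ [n] \<in> ?T" if "weight (v @ [n]) \<in> branch_set X g" for n
      using v(1,3) that prefix_order.antisym[of v s]
      by (auto simp: branch_nodes_def simp del: weight_snoc)
    have "\<exists>n\<ge>m. v @ [n] \<in> ?T" for m
    proof -
      obtain k where k: "weight v + m + 1 \<le> k" "k \<in> branch_set X g"
        using infinite_branch_set[OF assms] unfolding infinite_nat_iff_unbounded_le by blast
      then have "weight (v @ [k - weight v - 1]) = k"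
        by simp
      then show ?thesis
        using k in_T[of "k - weight v - 1"] by (intro exI[of _ "k - weight v - 1"]) auto
    qed
    then show ?thesis
      using v unfolding infinite_nat_iff_unbounded_le by blast
  qed
qed

definition branch_condition :: "nat set \<Rightarrow> nat list \<Rightarrow> nat set \<Rightarrow> miller" where
  "branch_condition X s g = Miller (branch_nodes X s g)"

lemma tree_branch_condition:
  "infinite X \<Longrightarrow> tree (branch_condition X s g) = branch_nodes X s g"
  by (simp add: branch_condition_def Miller_inverse miller_tree_branch_nodes)

text \<open>A common extension would contain nodes beyond \<open>s\<close> of arbitrarily large
  weight, all of them in the finite intersection of the two branch sets. Hence the generic filter
  determines at most one \<open>g\<close> for each \<open>(X, s)\<close>.\<close>

lemma branch_condition_incompatible:
  assumes X: "infinite X" and r: "r \<le> branch_condition X s g" "r \<le> branch_condition X s g'"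
  shows "g = g'"
proof (rule ccontr)
  assume "g \<noteq> g'"
  then obtain m where m: "\<And>k. k \<in> branch_set X g \<inter> branch_set X g' \<Longrightarrow> k \<le> m"
    using finite_branch_set_Int[OF X \<open>g \<noteq> g'\<close>] unfolding finite_nat_set_iff_bounded_le by auto
  obtain v where v: "split_node r v" "length s \<le> length v"
    using ex_long_split_node by blast
  obtain n where n: "n \<ge> m" "v @ [n] \<in> tree r"
    using v(1) by (rule split_node_succ)
  have "weight (v @ [n]) \<in> branch_set X h" if "r \<le> branch_condition X s h" for h
  proof -
    have "v @ [n] \<in> branch_nodes X s h"
      using n(2) that tree_branch_condition[OF X] by (auto simp: less_eq_miller_def)
    moreover have "\<not> prefix (v @ [n]) s"
      using v(2) by (auto dest: prefix_length_le)
    moreover have "s \<noteq> v @ [n]"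
      using v(2) by auto
    ultimately show ?thesis
      unfolding branch_nodes_def by (auto simp: strict_prefix_def)
  qed
  then have "weight (v @ [n]) \<le> m"
    using m r by blast
  then show False
    using n(1) by simp
qed

text \<open>The common extension is spanned by splitting nodes of \<open>p\<close>. From such a node
  the next one is reached inside the block that \<open>g\<close> selects on a rich level; which
  block this is does not matter, as all blocks of the level contain two points of
  \<open>Y\<close>.\<close>

lemma branch_condition_compatible:
  assumes X: "infinite X"
    and INFM: "INFM i. \<forall>j<2 ^ i. card (block X (2 ^ i + j) \<inter> Y) \<ge> 2"
    and Y: "\<And>a b t. a \<in> Y \<Longrightarrow> b \<in> Y \<Longrightarrow> a < b \<Longrightarrow> split_node p t \<Longrightarrow> weight t < a \<Longrightarrow>
      \<exists>n t'. split_node p t' \<and> prefix (t @ [n]) t' \<and> a \<le> weight (t @ [n]) \<and> weight t' < b"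
    and s: "split_node p s"
  shows "\<exists>q\<le>p. q \<le> branch_condition X s g"
proof -
  let ?T = "branch_nodes X s g"
  define W where "W = {t \<in> ?T. split_node p t \<and> prefix s t}"
  define S where "S = {u. \<exists>t\<in>W. prefix u t}"
  have "miller_tree S"
    unfolding miller_tree_def
  proof (intro conjI ballI allI impI)
    have "s \<in> W"
      using s by (simp add: W_def branch_nodes_def)
    then show "S \<noteq> {}"
      unfolding S_def by blast
    show "v \<in> S" if "u \<in> S" "prefix v u" for u v
      using that prefix_order.trans unfolding S_def by blast
    show "\<exists>t\<in>S. prefix u t \<and> infinite {n. t @ [n] \<in> S}" if "u \<in> S" for u
    proof -
      obtain t where t: "t \<in> W" "prefix u t"
        using \<open>u \<in> S\<close> unfolding S_def by blast
      have "\<exists>n\<ge>m. t @ [n] \<in> S" for m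
      proof -
        \<comment> \<open>A level this high forces \<open>a > weight t + m + 1\<close>; as
          \<open>a \<le> weight t + n + 1\<close> for the new successor, this gives
          \<open>n \<ge> m\<close>.\<close>
        obtain i where i: "i > weight t + m + 1" "\<forall>j<2 ^ i. card (block X (2 ^ i + j) \<inter> Y) \<ge> 2"
          using INFM unfolding INFM_nat by blast
        define k where "k = 2 ^ i + set_encode (g \<inter> {..<i})"
        have "i \<le> k"
          unfolding k_def by (metis less_exp less_imp_le trans_le_add1)
        then have "i \<le> enumerate X k"
          using le_enumerate[OF X] order_trans by blast
        have block: "block X k \<subseteq> branch_set X g"
          unfolding branch_set_def k_def by blast
        have "card (block X k \<inter> Y) \<ge> 2"
          using i(2) set_encode_less unfolding k_def by blast
        then obtain a b where ab: "a < b" "a \<in> Y" "b \<in> Y" "a \<in> block X k" "b \<in> block X k"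
          by (rule two_in_block)
        have a: "a > weight t + m + 1"
          using \<open>i \<le> enumerate X k\<close> i(1) ab(4) by simp
        obtain n t' where t': "split_node p t'" "prefix (t @ [n]) t'" "a \<le> weight (t @ [n])" "weight t' < b"
          using Y[OF ab(2,3,1)] t(1) a unfolding W_def by fastforce
        have "prefix s t'"
          using t(1) t'(2) unfolding W_def by (auto dest: append_prefixD prefix_order.trans)
        \<comment> \<open>The nodes after \<open>t\<close> up to \<open>t'\<close> have weights from
          \<open>a\<close> up to below \<open>b\<close>, and both \<open>a\<close> and
          \<open>b\<close> lie in the selected block.\<close>
        moreover have "weight v \<in> branch_set X g" if v: "prefix v t'" "strict_prefix s v" for v
        proof (cases "prefix v t")
          case True
          then have "\<not> prefix t s"
            using v(2) by (meson prefix_order.less_le_not_le prefix_order.trans)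
          then show ?thesis
            using t(1) v(2) True unfolding W_def branch_nodes_def by blast
        next
          case False
          then have "prefix (t @ [n]) v"
            using prefix_same_cases[OF t'(2) v(1)] by auto
          then have "a \<le> weight v" "weight v < b"
            using weight_mono[of "t @ [n]" v] weight_mono[OF v(1)] t'(3,4) by linarith+
          then have "weight v \<in> block X k"
            using ab(4,5) by simp
          then show ?thesis
            using block by blast
        qed
        ultimately have "t' \<in> W"
          using t'(1) unfolding W_def branch_nodes_def by blast
        then have "t @ [n] \<in> S"
          using t'(2) unfolding S_def by blast
        moreover have "n \<ge> m"
          using t'(3) a by simp
        ultimately show ?thesis by blast
      qed
      then show ?thesis
        using t unfolding infinite_nat_iff_unbounded_le S_def by blast
    qed
  qed
  then have "tree (Miller S) = S"
    by (simp add: Miller_inverse)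
  moreover have "S \<subseteq> tree p"
    unfolding S_def W_def split_node_def using tree_prefix by blast
  moreover have "S \<subseteq> ?T"
    unfolding S_def W_def using miller_tree_branch_nodes[OF X] unfolding miller_tree_def by blast
  ultimately show ?thesis
    by (intro exI[of _ "Miller S"]) (simp add: less_eq_miller_def tree_branch_condition[OF X])
qed

text \<open>\<open>Y\<close> is chosen from \<open>p\<close> alone: finitely many nodes have weight
  below \<open>a\<close>, so one \<open>b\<close> leaves room to extend all splitting nodes among
  them. Hence a single \<open>(X, s)\<close> serves every \<open>g\<close>, and below any condition
  every real of the ground model remains a possible value.\<close>

theorem weakly_dominating_branch_conditions:
  assumes F: "weakly_dominating F"
  obtains X s where "X \<in> F" "\<And>g. \<exists>q\<le>p. q \<le> branch_condition X s g"
proof -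
  let ?P = "\<lambda>a b. \<forall>t. split_node p t \<longrightarrow> weight t < a \<longrightarrow>
      (\<exists>n t'. split_node p t' \<and> prefix (t @ [n]) t' \<and> a \<le> weight (t @ [n]) \<and> weight t' < b)"
  have "\<exists>b. \<forall>c\<ge>b. ?P a c" for a
  proof -
    have "\<exists>t'. split_node p t' \<and> (\<exists>n. prefix (t @ [n]) t' \<and> a \<le> weight (t @ [n]))"
      if t: "split_node p t" for t
    proof -
      obtain n where n: "n \<ge> a" "t @ [n] \<in> tree p"
        using t by (rule split_node_succ)
      then obtain t' where "prefix (t @ [n]) t'" "split_node p t'"
        using ex_split_node by blast
      moreover have "a \<le> weight (t @ [n])"
        using n(1) by simp
      ultimately show ?thesis by blast
    qed
    then obtain f where f: "split_node p (f t)" "\<exists>n. prefix (t @ [n]) (f t) \<and> a \<le> weight (t @ [n])"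
      if "split_node p t" for t
      by metis
    let ?b = "Suc (Max ((\<lambda>t. weight (f t)) ` {t. weight t < a}))"
    have "weight (f t) < ?b" if "weight t < a" for t
      using that finite_weight_less by (simp add: less_Suc_eq_le)
    then show ?thesis
      using f by (intro exI[of _ ?b]) (meson order_less_le_trans)
  qed
  then have "\<exists>Y. infinite Y \<and> (\<forall>a\<in>Y. \<forall>b\<in>Y. a < b \<longrightarrow> ?P a b)"
    by (rule ex_sparse_set)
  then obtain Y where Y: "infinite Y" "\<forall>a\<in>Y. \<forall>b\<in>Y. a < b \<longrightarrow> ?P a b"
    by blast
  then obtain X where X: "X \<in> F" "INFM i. \<forall>j<2 ^ i. card (block X (2 ^ i + j) \<inter> Y) \<ge> 2"
    using F unfolding weakly_dominating_def by blast
  then have "infinite X"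
    using F unfolding weakly_dominating_def by blast
  obtain s where "split_node p s"
    using ex_long_split_node by blast
  then have "\<exists>q\<le>p. q \<le> branch_condition X s g" for g
    using branch_condition_compatible[OF \<open>infinite X\<close> X(2) _ \<open>split_node p s\<close>] Y(2) by blast
  with X(1) show thesis
    using that by blast
qed

section \<open>Names for reals\<close>

lemma card_of_subset_image:
  assumes "S \<subseteq> f ` A" "|A| \<le>o |B|"
  shows "|S| \<le>o |B|"
  using assms by (meson card_of_image card_of_mono1 ordLeq_transitive)

lemma card_of_countable_le_infinite:
  assumes "infinite A"
  shows "|UNIV :: 'b::countable set| \<le>o |A|"
proof (rule ordLeq_transitive)
  show "|UNIV :: 'b set| \<le>o |UNIV :: nat set|"
    using inj_to_nat by (blast intro: card_of_ordLeq[THEN iffD1])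
  show "|UNIV :: nat set| \<le>o |A|"
    using assms infinite_iff_card_of_nat by blast
qed

lemma Plus_eq_Plus_iff: "A <+> B = A' <+> B' \<longleftrightarrow> A = A' \<and> B = B'"
proof
  assume *: "A <+> B = A' <+> B'"
  have "Inl -` (A <+> B) = A" "Inr -` (A <+> B) = B" for A :: "'x set" and B :: "'y set"
    by auto
  then show "A = A' \<and> B = B'"
    using * by metis
qed simp

text \<open>A Miller tree is a set of finite sequences, so the triple is coded by one set of
  naturals. This bounds the name of the graph, whose elements are given by triples of a code, an
  element of \<open>F\<close> and a condition.\<close>

lemma card_of_conditions_le_continuum:
  "|UNIV :: (nat set \<times> nat set \<times> miller) set| \<le>o |UNIV :: nat set set|"
proof -
  have "inj (\<lambda>(A :: nat set, B :: nat set, p). to_nat ` (A <+> (B <+> tree p)))"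
    by (auto intro!: injI simp: inj_image_eq_iff[OF inj_to_nat] Plus_eq_Plus_iff tree_inject)
  then show ?thesis
    by (blast intro: card_of_ordLeq[THEN iffD1])
qed

lemma tree_top: "tree top = UNIV"
  unfolding top_miller_def by (rule Miller_inverse) (auto simp: miller_tree_def)

section \<open>Codes of reals and the forced power set of \<open>\<omega>\<close>\<close>

abbreviation num :: "nat \<Rightarrow> ('i, 'p::order_top) name" where
  "num \<equiv> check_below natLeq"

text \<open>
  The sections of \<open>g\<close> at those \<open>\<sigma>\<close> where they are Miller trees are the conditions that put
  \<open>length \<sigma>\<close> into the real, as produced by the fusion; the other sections are ignored.
\<close>

definition real_name :: "nat set \<Rightarrow> ('i, miller) name" where
  "real_name g = name_of {(num (length \<sigma>), S) | \<sigma> S. tree S = {u. to_nat (\<sigma> :: nat list, u) \<in> g}}"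

text \<open>The code whose \<open>real_name\<close> is the canonical name of \<open>b\<close>: the
  section at \<open>\<sigma>\<close> is the full tree, hence the condition \<open>top\<close>, if
  \<open>length \<sigma> \<in> b\<close>; otherwise it is empty, hence not a Miller tree.\<close>

definition ground_code :: "nat set \<Rightarrow> nat set" where
  "ground_code b = {to_nat (\<sigma>, u) | (\<sigma> :: nat list) (u :: nat list). length \<sigma> \<in> b}"

context
  assumes continuum_le: "|UNIV :: nat set set| \<le>o |UNIV :: 'i set|"
begin

lemma infinite_index: "infinite (UNIV :: 'i set)"
  using card_of_ordLeq_infinite[OF continuum_le] by (simp add: Finite_Set.finite_set)

lemma nat_le_index: "|Field natLeq| \<le>o |UNIV :: 'i set|"
  unfolding Field_natLeq
  by (rule card_of_countable_le_infinite[OF infinite_index])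

lemma elems_omega: "elems (\<omega>\<^sup>\<or> :: ('i, 'p::order_top) name) = {(num n, top) | n. True}"
  using elems_check_ordinal[OF nat_le_index] by (simp add: Field_natLeq)

lemma num_eqD: "eq (num n :: ('i, 'p::order_top) name) (num m) p \<Longrightarrow> n = m"
  by (rule check_below_eqD[OF natLeq_Well_order nat_le_index]) (simp_all add: Field_natLeq)

lemma elems_real_name:
  "elems (real_name g :: ('i, miller) name) =
    {(num (length \<sigma>), S) | \<sigma> S. tree S = {u. to_nat (\<sigma> :: nat list, u) \<in> g}}"
  unfolding real_name_def
proof (rule elems_name_of, rule card_of_subset_image)
  show "{(num (length \<sigma>) :: ('i, miller) name, S) | \<sigma> S. tree S = {u. to_nat (\<sigma> :: nat list, u) \<in> g}}
      \<subseteq> (\<lambda>\<sigma> :: nat list. (num (length \<sigma>), Miller {u. to_nat (\<sigma>, u) \<in> g})) ` UNIV"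
  proof safe
    fix \<sigma> S
    assume "tree S = {u. to_nat (\<sigma> :: nat list, u) \<in> g}"
    then have "S = Miller {u. to_nat (\<sigma>, u) \<in> g}"
      using tree_inverse[of S] by simp
    then show "(num (length \<sigma>) :: ('i, miller) name, S)
        \<in> (\<lambda>\<sigma> :: nat list. (num (length \<sigma>), Miller {u. to_nat (\<sigma>, u) \<in> g})) ` UNIV"
      by (intro image_eqI[of _ _ \<sigma>]) simp_all
  qed
  show "|UNIV :: nat list set| \<le>o |UNIV :: 'i set|"
    by (rule card_of_countable_le_infinite[OF infinite_index])
qed

lemma elems_real_name_ground_code:
  "elems (real_name (ground_code b) :: ('i, miller) name) = {(num n, top) | n. n \<in> b}"
proof -
  have "tree S = {u. to_nat (\<sigma> :: nat list, u) \<in> ground_code b} \<longleftrightarrow> length \<sigma> \<in> b \<and> S = top" for \<sigma> S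
  proof -
    have "{u :: nat list. to_nat (\<sigma>, u) \<in> ground_code b} = (if length \<sigma> \<in> b then UNIV else {})"
      by (auto simp: ground_code_def inj_eq[OF inj_to_nat])
    then show ?thesis
      using Nil_in_tree[of S] tree_top tree_inject[of S top] by auto
  qed
  then show ?thesis
    unfolding elems_real_name by (auto intro: exI[of _ "replicate n 0" for n])
qed

lemma real_name_ground_code_eqD:
  assumes "eq (real_name (ground_code b) :: ('i, miller) name) (real_name (ground_code b')) p"
  shows "b = b'"
proof -
  have "b \<subseteq> b'" if "eq (real_name (ground_code b) :: ('i, miller) name) (real_name (ground_code b')) p" for b b'
  proof
    fix n
    assume "n \<in> b"
    then have "mem (num n :: ('i, miller) name) (real_name (ground_code b)) p"
      by (intro memI[OF _ name_eq_refl top_greatest]) (auto simp: elems_real_name_ground_code)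
    then have "mem (num n :: ('i, miller) name) (real_name (ground_code b')) p"
      using that by (rule mem_cong_right)
    then show "n \<in> b'"
      by (rule memE) (auto simp: elems_real_name_ground_code dest: num_eqD)
  qed
  then show ?thesis
    using assms eq_sym by blast
qed

text \<open>Fusion for the dense sets of conditions deciding whether \<open>k\<close> belongs to
  \<open>x\<close>. The code collects the trees \<open>P \<sigma>\<close> that decide
  positively.\<close>

lemma ex_real_name:
  fixes x :: "('i, miller) name"
  assumes x: "\<And>z q. q \<le> p \<Longrightarrow> mem z x q \<Longrightarrow> mem z \<omega>\<^sup>\<or> q"
  shows "\<exists>q\<le>p. \<exists>g. eq x (real_name g :: ('i, miller) name) q"
proof -
  let ?D = "\<lambda>k q. mem (num k) x q \<or> (\<forall>r\<le>q. \<not> mem (num k) x r)"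
  have "\<exists>q\<le>p. ?D k q" for k p
    by (meson order.refl)
  then obtain q P where q: "q \<le> p" and D: "\<And>\<sigma>. ?D (length \<sigma>) (P \<sigma>)"
    and P: "\<And>k r. r \<le> q \<Longrightarrow> \<exists>\<sigma>::nat list. length \<sigma> = k \<and> (\<exists>s\<le>r. s \<le> P \<sigma>)"
    by (rule miller_fusion[of ?D p]) blast
  define g where "g = {to_nat (\<sigma>, u) | \<sigma> u. mem (num (length \<sigma>)) x (P \<sigma>) \<and> u \<in> tree (P \<sigma>)}"
  have "tree S = {u. to_nat (\<sigma>, u) \<in> g} \<longleftrightarrow> mem (num (length \<sigma>)) x (P \<sigma>) \<and> S = P \<sigma>" for \<sigma> S
  proof -
    have "{u. to_nat (\<sigma>, u) \<in> g} = (if mem (num (length \<sigma>)) x (P \<sigma>) then tree (P \<sigma>) else {})"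
      by (auto simp: g_def inj_eq[OF inj_to_nat])
    then show ?thesis
      using Nil_in_tree[of S] tree_inject by auto
  qed
  then have elems: "elems (real_name g :: ('i, miller) name) =
      {(num (length \<sigma>), P \<sigma>) | \<sigma>. mem (num (length \<sigma>)) x (P \<sigma>)}"
    unfolding elems_real_name by auto
  have "eq x (real_name g) q"
  proof (rule eqI)
    fix z r
    assume r: "r \<le> q" and z: "mem z x r"
    show "mem z (real_name g) r"
    proof (rule regular_dense[OF regular_mem])
      fix r'
      assume r': "r' \<le> r"
      then have "mem z x r'"
        using z mem_mono by blast
      then have "mem z \<omega>\<^sup>\<or> r'"
        using x r' r q order_trans by meson
      then obtain n s where s: "s \<le> r'" "eq z (num n) s"
        by (rule memE) (auto simp: elems_omega)
      then have "s \<le> q"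
        using r r' by simp
      then obtain \<sigma> s' where \<sigma>: "length \<sigma> = n" "s' \<le> s" "s' \<le> P \<sigma>"
        using P by blast
      have z': "eq z (num n) s'"
        using s(2) \<sigma>(2) eq_mono by blast
      have "mem z x s'"
        using \<open>mem z x r'\<close> s(1) \<sigma>(2) mem_mono by blast
      then have "mem (num n) x s'"
        using z' mem_cong_left by blast
      \<comment> \<open>\<open>P \<sigma>\<close> decides the question, and the negative answer is
        refuted by \<open>s' \<le> P \<sigma>\<close>.\<close>
      then have "mem (num n) x (P \<sigma>)"
        using D[of \<sigma>] \<sigma> by blast
      then have "mem z (real_name g) s'"
        using memI[OF _ z' \<sigma>(3)] \<sigma>(1) elems by blast
      then show "\<exists>s\<le>r'. mem z (real_name g) s"
        using s(1) \<sigma>(2) order_trans by blast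
    qed
  next
    fix z :: "('i, miller) name" and r
    assume z: "mem z (real_name g) r"
    show "mem z x r"
    proof (rule regular_dense[OF regular_mem])
      fix r'
      assume "r' \<le> r"
      with z have "mem z (real_name g) r'"
        using mem_mono by blast
      then obtain w t s where s: "(w, t) \<in> elems (real_name g :: ('i, miller) name)" "s \<le> r'" "s \<le> t" "eq z w s"
        by (rule memE)
      then have "mem w x s"
        using mem_mono unfolding elems by blast
      then show "\<exists>s\<le>r'. mem z x s"
        using s mem_cong_left eq_sym by blast
    qed
  qed
  with q show ?thesis
    by blast
qed

text \<open>By \<open>ex_real_name\<close>, a forced subset of \<open>\<omega>\<close> is densely
  equal to a coded real, and regularity of \<open>mem\<close> turns this into membership in
  \<open>c\<close>.\<close>

lemma is_power_set_real_names:
  fixes c :: "('i, miller) name"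
  assumes c: "elems c = {(real_name g, top) | g. g \<in> UNIV}"
  shows "is_power_set c \<omega>\<^sup>\<or> p"
proof -
  have mem_c: "mem x c q" if "eq x (real_name g) q" for x g q
    by (rule memI[OF _ that top_greatest]) (use c in blast)
  have sub: "mem z \<omega>\<^sup>\<or> q" if "mem x c q" "mem z x q" for x z :: "('i, miller) name" and q
  proof (rule regular_dense[OF regular_mem])
    fix r
    assume "r \<le> q"
    then have "mem x c r" "mem z x r"
      using that mem_mono by blast+
    from \<open>mem x c r\<close> obtain w t s where w: "(w, t) \<in> elems c" and s: "s \<le> r" "eq x w s"
      by (rule memE)
    from w obtain g where g: "w = real_name g"
      unfolding c by blast
    have "mem z (real_name g) s"
      using s(2)[unfolded g] \<open>mem z x r\<close> s(1) mem_mono mem_cong_right by blast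
    then obtain n s' where s': "s' \<le> s" "eq z (num n) s'"
      by (rule memE) (auto simp: elems_real_name)
    then have "mem z \<omega>\<^sup>\<or> s'"
      by (intro memI[OF _ _ top_greatest]) (auto simp: elems_omega)
    then show "\<exists>s\<le>r. mem z \<omega>\<^sup>\<or> s"
      using s'(1) s(1) order_trans by blast
  qed
  have "mem x c q \<longleftrightarrow> (\<forall>z. \<forall>r\<le>q. mem z x r \<longrightarrow> mem z \<omega>\<^sup>\<or> r)" for x q
  proof
    show "mem x c q" if *: "\<forall>z. \<forall>r\<le>q. mem z x r \<longrightarrow> mem z \<omega>\<^sup>\<or> r"
    proof (rule regular_dense[OF regular_mem])
      show "\<exists>s\<le>r. mem x c s" if "r \<le> q" for r
        using ex_real_name[of r x] * that mem_c order_trans by meson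
    qed
  qed (use sub mem_mono in blast)
  moreover have "(\<^bold>\<forall>z. z \<^bold>\<in> x \<^bold>\<longrightarrow> z \<^bold>\<in> \<omega>\<^sup>\<or>) q \<longleftrightarrow> (\<forall>z. \<forall>r\<le>q. mem z x r \<longrightarrow> mem z \<omega>\<^sup>\<or> r)"
    for x :: "('i, miller) name" and q
    unfolding All_name_def by (simp add: Imp_iff regular_mem)
  ultimately show ?thesis
    unfolding is_power_set_def All_name_def[of _ p]
    by (simp add: Iff_iff regular_mem regular_All regular_Imp)
qed

end

section \<open>The bijection between the continuum and
  \<open>\<bb>\<^sup>+\<^sup>\<epsilon>\<close>\<close>

theorem theorem4p4:
  assumes "|UNIV :: nat set set| \<le>o |UNIV :: 'i set|"
  shows "\<tturnstile> \<^bold>\<exists>c :: ('i, miller) name. is_power_set c \<omega>\<^sup>\<or> \<^bold>\<and> same_cardinality c (check_ordinal \<bb>\<^sup>+\<^sup>\<epsilon>)"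
proof -
  obtain F where F: "weakly_dominating F" and b: "\<bb>\<^sup>+\<^sup>\<epsilon> = |F|"
    by (rule b_plus_eps_minimal) blast
  have infF: "infinite F"
    using weakly_dominating_infinite[OF F] .
  have infX: "infinite X" if "X \<in> F" for X
    using F that unfolding weakly_dominating_def by blast
  define K where "K = F \<times> (UNIV :: nat list set)"
  have F_K: "|F| =o |K|"
    unfolding K_def using infF card_of_countable_le_infinite[OF infF]
    by (intro card_of_Times_infinite_simps) auto
  then have "infinite K"
    using infF card_of_ordIso_finite by blast
  then have "|K| =o |K \<times> (UNIV :: nat set)|"
    using card_of_countable_le_infinite by (intro card_of_Times_infinite_simps) auto
  \<comment> \<open>The generic bijection will be indexed by \<open>K \<times> \<omega>\<close>,
    whereas the field of \<open>\<bb>\<^sup>+\<^sup>\<epsilon>\<close> is \<open>F\<close>;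
    \<open>\<rho>\<close> translates between them.\<close>
  with F_K obtain \<rho> where "bij_betw \<rho> F (K \<times> (UNIV :: nat set))"
    using ordIso_transitive card_of_ordIso by blast
  then have \<rho>: "inj_on \<rho> F" "\<rho> ` F = K \<times> UNIV"
    by (simp_all add: bij_betw_def)
  \<comment> \<open>\<open>p\<close> puts the tree of \<open>k = (X, s)\<close> and \<open>g\<close>
    into the generic filter.\<close>
  define val where "val k g p \<longleftrightarrow> k \<in> K \<and> p \<le> branch_condition (fst k) (snd k) g" for k g p
  \<comment> \<open>The reserve for the bijection: each \<open>k = (X, s)\<close> receives
    infinitely many ground-model reals of its own, \<open>n\<close> and \<open>s\<close> being
    stored with every element of \<open>X\<close>.\<close>
  define x where "x k n = ground_code ((\<lambda>m. to_nat (m :: nat, snd k :: nat list, n :: nat)) ` fst k)" for k n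
  have x_inj: "k = k' \<and> n = n'"
    if "eq (real_name (x k n) :: ('i, miller) name) (real_name (x k' n')) p" "k \<in> K" "k' \<in> K" for k k' n n' p
  proof -
    have "(\<lambda>m. to_nat (m, snd k, n)) ` fst k = (\<lambda>m. to_nat (m, snd k', n')) ` fst k'"
      using real_name_ground_code_eqD[OF assms that(1)[unfolded x_def]] .
    then have "to_nat ` (fst k \<times> {(snd k, n)}) = to_nat ` (fst k' \<times> {(snd k', n')})"
      by auto
    then have "fst k \<times> {(snd k, n)} = fst k' \<times> {(snd k', n')}"
      by (simp only: inj_image_eq_iff[OF inj_to_nat])
    \<comment> \<open>An element of \<open>X\<close> is needed to read \<open>s\<close> and
      \<open>n\<close> off the product.\<close>
    moreover have "fst k \<noteq> {}"
      using that(2) infX by (force simp: K_def)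
    ultimately have "fst k = fst k'" "snd k = snd k'" "n = n'"
      by (auto simp: times_eq_iff)
    then show ?thesis
      by (simp add: prod_eq_iff)
  qed
  have val_surj: "\<exists>k. \<exists>q\<le>p. val k g q" for g p
  proof -
    obtain X s where "X \<in> F" "\<And>g. \<exists>q\<le>p. q \<le> branch_condition X s g"
      using weakly_dominating_branch_conditions[OF F] by blast
    then show ?thesis
      unfolding val_def K_def by (intro exI[of _ "(X, s)"]) auto
  qed
  have val_func: "g = g'" if "val k g p" "val k g' p" for k g g' p
    using that branch_condition_incompatible[of "fst k"] infX[of "fst k"]
    unfolding val_def K_def by (metis mem_Times_iff)
  show ?thesis
  proof (rule generic_bijection[of val K real_name x])
    show "k \<in> K" if "val k g p" for k g p
      using that unfolding val_def by blast
    show "val k g q" if "val k g p" "q \<le> p" for k g p q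
      using that order_trans unfolding val_def by blast
  next
    fix R
    assume R: "\<And>g a p. R g a p \<Longrightarrow> a \<in> K \<times> (UNIV :: nat set)"
      "\<And>g a p q. R g a p \<Longrightarrow> q \<le> p \<Longrightarrow> R g a q"
      "\<And>g g' a p. R g a p \<Longrightarrow> R g' a p \<Longrightarrow> g = g'"
      "\<And>g g' a a' p. R g a p \<Longrightarrow> R g' a' p \<Longrightarrow>
        eq (real_name g :: ('i, miller) name) (real_name g') p \<Longrightarrow> a = a'"
      "\<And>a p. a \<in> K \<times> UNIV \<Longrightarrow> \<exists>g q. q \<le> p \<and> R g a q"
      "\<And>g p. \<exists>g' a q. q \<le> p \<and> R g' a q \<and> eq (real_name g :: ('i, miller) name) (real_name g') q"
    let ?\<beta> = "check_below \<bb>\<^sup>+\<^sup>\<epsilon> :: nat set \<Rightarrow> ('i, miller) name"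
    let ?b = "check_ordinal \<bb>\<^sup>+\<^sup>\<epsilon> :: ('i, miller) name"
    have wo: "Well_order \<bb>\<^sup>+\<^sup>\<epsilon>" and Field_b: "Field \<bb>\<^sup>+\<^sup>\<epsilon> = F"
      unfolding b by (rule card_of_Well_order, simp add: Field_card_of)
    have b_le: "|Field \<bb>\<^sup>+\<^sup>\<epsilon>| \<le>o |UNIV :: 'i set|"
      using card_of_mono1[OF subset_UNIV] assms by (rule ordLeq_transitive)
    \<comment> \<open>With \<open>top\<close> at every code, one name serves as the power set below
      all conditions.\<close>
    define c where "c = (name_of {(real_name g, top) | g. g \<in> UNIV} :: ('i, miller) name)"
    define f where "f = (name_of {(opair_name (real_name g) (?\<beta> a), p) | g a p. a \<in> F \<and> R g (\<rho> a) p}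
      :: ('i, miller) name)"
    have "|{(real_name g :: ('i, miller) name, top :: miller) | g. g \<in> UNIV}| \<le>o |UNIV :: 'i set|"
      by (rule card_of_subset_image[OF _ assms, of _ "\<lambda>g. (real_name g, top)"]) blast
    then have c: "elems c = {(real_name g, top) | g. g \<in> UNIV}"
      unfolding c_def by (rule elems_name_of)
    have "|{(opair_name (real_name g) (?\<beta> a), p) | g a p. a \<in> F \<and> R g (\<rho> a) p}| \<le>o |UNIV :: 'i set|"
      by (rule card_of_subset_image[OF _ ordLeq_transitive[OF card_of_conditions_le_continuum assms],
            of _ "\<lambda>(g, a, p). (opair_name (real_name g) (?\<beta> a), p)"]) (auto simp: image_iff, blast)
    then have f: "elems f = {(opair_name (real_name g) (?\<beta> a), p) | g a p. a \<in> F \<and> R g (\<rho> a) p}"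
      unfolding f_def by (rule elems_name_of)
    have "is_bijection f c ?b p" for p
    proof (rule is_bijectionI[OF infinite_index[OF assms] c _ f])
      show "elems ?b = {(?\<beta> a, top) | a. a \<in> F}"
        using elems_check_ordinal[OF b_le] unfolding Field_b .
      show "a = a'" if "eq (?\<beta> a) (?\<beta> a') p" "a \<in> F" "a' \<in> F" for a a' p
        using check_below_eqD[OF wo b_le] that unfolding Field_b by blast
      show "eq (real_name g :: ('i, miller) name) (real_name g') p"
        if "a \<in> F \<and> R g (\<rho> a) p" "a \<in> F \<and> R g' (\<rho> a) p" for g g' a p
        using that R(3) name_eq_refl by blast
      show "a = a'" if "a \<in> F \<and> R g (\<rho> a) p" "a' \<in> F \<and> R g' (\<rho> a') p"
        "eq (real_name g :: ('i, miller) name) (real_name g') p" for g g' a a' p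
        using that R(4) inj_onD[OF \<rho>(1)] by blast
      show "\<exists>g q. q \<le> p \<and> a \<in> F \<and> R g (\<rho> a) q" if "a \<in> F" for a p
        using that R(5)[of "\<rho> a" p] \<rho>(2) by blast
      show "\<exists>g' a q. q \<le> p \<and> (a \<in> F \<and> R g' (\<rho> a) q) \<and>
        eq (real_name g :: ('i, miller) name) (real_name g') q" for g p
      proof -
        obtain g' k q where q: "q \<le> p" "R g' k q" "eq (real_name g :: ('i, miller) name) (real_name g') q"
          using R(6) by blast
        then obtain a where "a \<in> F" "\<rho> a = k"
          using R(1)[OF q(2)] \<rho>(2) by (metis imageE)
        with q show ?thesis
          by blast
      qed
    qed (use R(2) in blast)+
    then have "same_cardinality c ?b p" for p
      unfolding same_cardinality_def Ex_name_iff by blast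
    then have "(is_power_set c \<omega>\<^sup>\<or> \<^bold>\<and> same_cardinality c ?b) p" for p
      unfolding Conj_def using is_power_set_real_names[OF assms c] by blast
    then show ?thesis
      unfolding forced_def Ex_name_iff by blast
  qed (fact val_func val_surj x_inj)+
qed

end
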